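(* Let $\eta$ be a multiplier function. For every integer $m\ge1$ and every $f\in L^2(B^2)$, the function $S_{2m}^\eta f$ can be written as $$S_{2m}^\eta(f;x,y)=\sum_{\nu=0}^{2m}\frac1\pi\int_{-1}^1\mathcal{R}_{\phi_\nu}(f;t)\,\Phi_\nu^\eta(t;x,y)\,dt,$$ where $$\Phi_\nu^\eta(t;x,y)=\frac{1}{2m+1}\sum_{k=0}^{2m}\eta\left(\frac km\right)(k+1)\,U_k(t)\,U_k(\phi_\nu;x,y),\qquad \phi_\nu=\frac{2\pi\nu}{2m+1}.$$
   Context: $B^2=\{(x,y)\in\mathbb{R}^2: x^2+y^2\le 1\}$. A multiplier function is a function $\eta\in C^r[0,\infty)$, $r$ a positive integer, with $\eta(t)=1$ for $0\le t\le1$ and $\operatorname{supp}\eta\subset[0,2]$. The Radon projection of $f$ is $$\mathcal{R}_\theta(f;t)=\int_{-\sqrt{1-t^2}}^{\sqrt{1-t^2}} f(t\cos\theta - s\sin\theta,\ t\sin\theta+s\cos\theta)\,ds$$ (defined for almost every $t\in[-1,1]$). $U_k$ is the Chebyshev polynomial of the second kind, $U_k(\cos\theta)=\sin((k+1)\theta)/\sin\theta$, and $U_k(\theta;x,y):=U_k(x\cos\theta+y\sin\theta)$. $\Pi_n^2$ is the space of real polynomials in two variables of total degree at most $n$; $\mathcal{V}_k(B^2)$ is the space of polynomials $P$ of degree $k$ (together with $0$) with $\int_{B^2}PQ\,dx\,dy=0$ for all $Q\in\Pi_{k-1}^2$; $\operatorname{proj}_kf$ is the orthogonal projection of $f\in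 L^2(B^2)$ onto $\mathcal{V}_k(B^2)$. The operator $S_{2m}^\eta$ is $S_{2m}^\eta f=\sum_{k=0}^{2m}\eta\left(\frac km\right)\operatorname{proj}_kf$. *)

theory Defs
  imports "HOL-Analysis.Analysis" "HOL-Computational_Algebra.Polynomial"
begin

text \<open>Functions on the disk \<open>B2\<close> are total functions on the plane whose values off \<open>B2\<close> are
  irrelevant; all integrals are Lebesgue integrals with respect to (completed) Lebesgue measure.\<close>

definition B2 :: "(real \<times> real) set"
  where "B2 = {(x, y). x\<^sup>2 + y\<^sup>2 \<le> 1}"

text \<open>At a boundary point of \<open>A\<close> the derivatives are one-sided.\<close>

definition continuously_differentiable_on :: "nat \<Rightarrow> (real \<Rightarrow> real) \<Rightarrow> real set \<Rightarrow> bool"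
  where "continuously_differentiable_on r f A \<longleftrightarrow>
    (\<exists>D :: nat \<Rightarrow> real \<Rightarrow> real.
       (\<forall>t\<in>A. D 0 t = f t) \<and>
       (\<forall>j<r. \<forall>t\<in>A. (D j has_real_derivative D (Suc j) t) (at t within A)) \<and>
       continuous_on A (D r))"

definition multiplier_function :: "nat \<Rightarrow> (real \<Rightarrow> real) \<Rightarrow> bool"
  where "multiplier_function r \<eta> \<longleftrightarrow>
    r \<ge> 1 \<and>
    continuously_differentiable_on r \<eta> {0..} \<and>
    (\<forall>t\<in>{0..1}. \<eta> t = 1) \<and>
    closure {t\<in>{0..}. \<eta> t \<noteq> 0} \<subseteq> {0..2}"

definition L2_disk :: "(real \<times> real \<Rightarrow> real) set"
  where "L2_disk = {f. f \<in> borel_measurable (lebesgue_on B2) \<and>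
                       integrable (lebesgue_on B2) (\<lambda>p. (f p)\<^sup>2)}"

definition chord_fun :: "real \<Rightarrow> (real \<times> real \<Rightarrow> real) \<Rightarrow> real \<Rightarrow> real \<Rightarrow> real"
  where "chord_fun \<theta> f t s = f (t * cos \<theta> - s * sin \<theta>, t * sin \<theta> + s * cos \<theta>)"

text \<open>For \<open>f\<close> in \<open>L2_disk\<close> the integral exists for almost every \<open>t\<close>; at the exceptional \<open>t\<close> the
  Bochner integral takes its default value \<open>0\<close>.\<close>

definition radon :: "real \<Rightarrow> (real \<times> real \<Rightarrow> real) \<Rightarrow> real \<Rightarrow> real"
  where "radon \<theta> f t = (LINT s:{- sqrt (1 - t\<^sup>2)..sqrt (1 - t\<^sup>2)}|lebesgue. chord_fun \<theta> f t s)"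

definition chebyshev_U :: "nat \<Rightarrow> real poly"
  where "chebyshev_U k =
    (THE p. \<forall>\<theta>. sin \<theta> \<noteq> 0 \<longrightarrow> poly p (cos \<theta>) = sin (real (k + 1) * \<theta>) / sin \<theta>)"

lemma chebyshev_U_exists:
  "\<exists>p :: real poly. \<forall>\<theta>. sin \<theta> \<noteq> 0 \<longrightarrow> poly p (cos \<theta>) = sin (real (k + 1) * \<theta>) / sin \<theta>"
proof (induction k rule: less_induct)
  case (less k)
  consider "k = 0" | "k = 1" | j where "k = Suc (Suc j)"
    by (metis One_nat_def not0_implies_Suc)
  then show ?case
  proof cases
    case 1
    then show ?thesis by (intro exI[of _ 1]) simp
  next
    case 2
    then show ?thesis by (intro exI[of _ "[:0, 2:]"]) (simp add: sin_double)
  next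
    case 3
    obtain p q :: "real poly" where
      p: "\<And>\<theta>. sin \<theta> \<noteq> 0 \<Longrightarrow> poly p (cos \<theta>) = sin (real (j + 1) * \<theta>) / sin \<theta>" and
      q: "\<And>\<theta>. sin \<theta> \<noteq> 0 \<Longrightarrow> poly q (cos \<theta>) = sin (real (Suc j + 1) * \<theta>) / sin \<theta>"
      using less.IH[of j] less.IH[of "Suc j"] 3 by auto
    have "poly ([:0, 2:] * q - p) (cos \<theta>) = sin (real (k + 1) * \<theta>) / sin \<theta>"
      if "sin \<theta> \<noteq> 0" for \<theta>
    proof -
      define a where "a = real (j + 2) * \<theta>"
      have eqs: "real (k + 1) * \<theta> = a + \<theta>" "real (j + 1) * \<theta> = a - \<theta>" "real (Suc j + 1) * \<theta> = a"
        using 3 by (simp_all add: a_def algebra_simps)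
      have "poly p (cos \<theta>) = sin (a - \<theta>) / sin \<theta>" "poly q (cos \<theta>) = sin a / sin \<theta>"
        using p[OF that] q[OF that] unfolding eqs by blast+
      then show ?thesis
        unfolding eqs using that by (simp add: sin_add sin_diff field_simps)
    qed
    then show ?thesis by blast
  qed
qed

lemma poly_chebyshev_U_cos:
  assumes "sin \<theta> \<noteq> 0"
  shows "poly (chebyshev_U k) (cos \<theta>) = sin (real (k + 1) * \<theta>) / sin \<theta>"
proof -
  let ?P = "\<lambda>p :: real poly. \<forall>\<theta>. sin \<theta> \<noteq> 0 \<longrightarrow>
              poly p (cos \<theta>) = sin (real (k + 1) * \<theta>) / sin \<theta>"
  have uniq: "p = q" if "?P p" "?P q" for p q
  proof (rule ccontr)
    assume "p \<noteq> q"
    then have "finite {x. poly (p - q) x = 0}"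
      by (intro poly_roots_finite) simp
    moreover have "{-1<..<1} \<subseteq> {x. poly (p - q) x = 0}"
    proof
      fix x :: real assume "x \<in> {-1<..<1}"
      then have "cos (arccos x) = x" "sin (arccos x) \<noteq> 0"
        using sin_arccos_nonzero[of x] by auto
      then show "x \<in> {x. poly (p - q) x = 0}"
        using that by (metis (mono_tags) diff_self mem_Collect_eq poly_diff)
    qed
    ultimately show False
      using infinite_Ioo[of "-1 :: real" 1] by (meson finite_subset less_trans neg_less_0_iff_less zero_less_one)
  qed
  have "\<exists>!p. ?P p"
    using chebyshev_U_exists[of k] uniq by blast
  from theI'[OF this] show ?thesis
    unfolding chebyshev_U_def[symmetric] using assms by blast
qed

abbreviation chebU :: "nat \<Rightarrow> real \<Rightarrow> real"
  where "chebU k t \<equiv> poly (chebyshev_U k) t"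

definition ridge_U :: "nat \<Rightarrow> real \<Rightarrow> real \<Rightarrow> real \<Rightarrow> real"
  where "ridge_U k \<theta> x y = chebU k (x * cos \<theta> + y * sin \<theta>)"

text \<open>Bivariate polynomials are identified with their functions on the plane. The degree bound
  is an integer so that \<open>poly2_upto (-1)\<close> is the zero space.\<close>

definition poly2_upto :: "int \<Rightarrow> (real \<times> real \<Rightarrow> real) set"
  where "poly2_upto n =
    {P. \<exists>c :: nat \<Rightarrow> nat \<Rightarrow> real.
          P = (\<lambda>(x, y). \<Sum>(i, j)\<in>{(i, j). int (i + j) \<le> n}. c i j * x ^ i * y ^ j)}"

definition inner_disk :: "(real \<times> real \<Rightarrow> real) \<Rightarrow> (real \<times> real \<Rightarrow> real) \<Rightarrow> real"
  where "inner_disk f g = (LINT p:B2|lebesgue. f p * g p)"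

definition orth_poly_space :: "nat \<Rightarrow> (real \<times> real \<Rightarrow> real) set"
  where "orth_poly_space k =
    insert (\<lambda>_. 0)
      {P \<in> poly2_upto (int k) - poly2_upto (int k - 1).
         \<forall>Q \<in> poly2_upto (int k - 1). inner_disk P Q = 0}"

text \<open>A polynomial is determined by its values on the disk, so the projection is a genuine function
  and not merely a class modulo null sets.\<close>

definition proj :: "nat \<Rightarrow> (real \<times> real \<Rightarrow> real) \<Rightarrow> real \<times> real \<Rightarrow> real"
  where "proj k f =
    (THE P. P \<in> orth_poly_space k \<and>
            (\<forall>Q \<in> orth_poly_space k. inner_disk (\<lambda>p. f p - P p) Q = 0))"

text \<open>\<open>S_op \<eta> m\<close> is the operator usually written with the subscript \<open>2m\<close>.\<close>

definition S_op :: "(real \<Rightarrow> real) \<Rightarrow> nat \<Rightarrow> (real \<times> real \<Rightarrow> real) \<Rightarrow> real \<times> real \<Rightarrow> real"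
  where "S_op \<eta> m f p = (\<Sum>k=0..2*m. \<eta> (real k / real m) * proj k f p)"

definition angle :: "nat \<Rightarrow> nat \<Rightarrow> real"
  where "angle m \<nu> = 2 * pi * real \<nu> / real (2 * m + 1)"

definition Phi :: "(real \<Rightarrow> real) \<Rightarrow> nat \<Rightarrow> nat \<Rightarrow> real \<Rightarrow> real \<Rightarrow> real \<Rightarrow> real"
  where "Phi \<eta> m \<nu> t x y =
    1 / real (2 * m + 1) *
    (\<Sum>k=0..2*m. \<eta> (real k / real m) * real (k + 1) * chebU k t * ridge_U k (angle m \<nu>) x y)"

end

theory Submission
  imports Defs
begin

text \<open>By Fubini in rotated coordinates, integrating \<open>\<R>\<^sub>\<theta> f\<close> against \<open>q\<close> gives the inner product of
  \<open>f\<close> with the ridge function \<open>q (x cos \<theta> + y sin \<theta>)\<close>. For \<open>P \<in> V\<^sub>k\<close> the Radon projection is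
  \<open>sqrt (1 - t\<^sup>2)\<close> times a polynomial of degree at most \<open>k\<close> that is orthogonal, for this weight, to
  everything of lower degree; so it is a multiple of \<open>U\<^sub>k\<close>, and evaluation at \<open>t = 1\<close> yields
  \<open>\<langle>P, U\<^sub>k(\<theta>)\<rangle> = \<pi> / (k + 1) P (cos \<theta>, sin \<theta>)\<close>. In particular an element of \<open>V\<^sub>k\<close> is determined
  by its values on the circle. There \<open>U\<^sub>k (cos (\<alpha> - \<beta>))\<close> is a trigonometric polynomial that the
  equally spaced angles \<open>\<phi>\<^sub>\<nu>\<close> reproduce exactly as long as \<open>k \<le> 2m\<close>, so the ridge functions
  \<open>U\<^sub>k(\<phi>\<^sub>\<nu>)\<close> give the reproducing kernel of \<open>V\<^sub>k\<close> and hence \<open>proj\<^sub>k\<close>.\<close>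

section \<open>Chebyshev polynomials\<close>

lemma poly_eqI_Ioo:
  fixes p q :: "real poly"
  assumes "a < b" "\<And>x. x \<in> {a<..<b} \<Longrightarrow> poly p x = poly q x"
  shows "p = q"
proof (rule ccontr)
  assume "p \<noteq> q"
  then have "finite {x. poly (p - q) x = 0}"
    by (intro poly_roots_finite) simp
  moreover have "{a<..<b} \<subseteq> {x. poly (p - q) x = 0}"
    using assms(2) by auto
  ultimately show False
    using infinite_Ioo[OF assms(1)] finite_subset by blast
qed

text \<open>\<open>chebyshev_U\<close> is a definite description; this identifies it with any
  polynomial that has the right values. The angles with nonzero sine already reach every point
  strictly between -1 and 1, which is enough to fix a polynomial.\<close>

lemma chebyshev_U_eqI:
  assumes "\<And>\<theta>. sin \<theta> \<noteq> 0 \<Longrightarrow> poly p (cos \<theta>) = sin (real (k + 1) * \<theta>) / sin \<theta>"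
  shows "chebyshev_U k = p"
proof (rule poly_eqI_Ioo[of "-1" 1])
  fix x :: real assume "x \<in> {-1<..<1}"
  then have "cos (arccos x) = x" "sin (arccos x) \<noteq> 0"
    using sin_arccos_nonzero[of x] by auto
  then show "poly (chebyshev_U k) x = poly p x"
    using assms poly_chebyshev_U_cos by metis
qed simp

lemma chebyshev_U_0 [simp]: "chebyshev_U 0 = 1"
  by (rule chebyshev_U_eqI) simp

lemma chebyshev_U_1 [simp]: "chebyshev_U (Suc 0) = [:0, 2:]"
  by (rule chebyshev_U_eqI) (simp add: sin_double)

lemma chebyshev_U_Suc_Suc:
  "chebyshev_U (Suc (Suc k)) = [:0, 2:] * chebyshev_U (Suc k) - chebyshev_U k"
proof (rule chebyshev_U_eqI)
  fix \<theta> :: real assume *: "sin \<theta> \<noteq> 0"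
  define a where "a = real (k + 2) * \<theta>"
  have eqs: "real (Suc (Suc k) + 1) * \<theta> = a + \<theta>" "real (k + 1) * \<theta> = a - \<theta>"
    "real (Suc k + 1) * \<theta> = a"
    by (simp_all add: a_def algebra_simps)
  show "poly ([:0, 2:] * chebyshev_U (Suc k) - chebyshev_U k) (cos \<theta>)
      = sin (real (Suc (Suc k) + 1) * \<theta>) / sin \<theta>"
    using * unfolding poly_diff poly_mult poly_chebyshev_U_cos[OF *] eqs
    by (simp add: sin_add sin_diff field_simps)
qed

text \<open>That the top coefficient is nonzero is what makes the expansion in
  \<open>chebyshev_U_span\<close> possible.\<close>

lemma degree_chebyshev_U_le: "degree (chebyshev_U k) \<le> k"
  and coeff_chebyshev_U: "coeff (chebyshev_U k) k = 2 ^ k"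
proof -
  have "degree (chebyshev_U k) \<le> k \<and> coeff (chebyshev_U k) k = 2 ^ k"
  proof (induction k rule: induct_nat_012)
    case (ge2 k)
    have "degree ([:0, 2:] * chebyshev_U (Suc k)) \<le> Suc (Suc k)"
      using degree_mult_le[of "[:0, 2::real:]" "chebyshev_U (Suc k)"] ge2 by simp
    then show ?case
      using ge2 by (simp add: chebyshev_U_Suc_Suc degree_diff_le coeff_eq_0)
  qed auto
  then show "degree (chebyshev_U k) \<le> k" "coeff (chebyshev_U k) k = 2 ^ k" by auto
qed

lemma chebU_one: "chebU k 1 = real (k + 1)"
  by (induction k rule: induct_nat_012) (simp_all add: chebyshev_U_Suc_Suc)

text \<open>Triangularity: subtracting the multiple of \<open>chebyshev_U (Suc k)\<close> that
  cancels the top coefficient lowers the degree bound by one.\<close>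

lemma chebyshev_U_span:
  assumes "degree p \<le> k"
  shows "\<exists>a. p = (\<Sum>l\<le>k. smult (a l) (chebyshev_U l))"
  using assms
proof (induction k arbitrary: p)
  case 0
  then obtain c where "p = [:c:]" by (metis degree_eq_zeroE le_0_eq)
  then show ?case by (intro exI[of _ "\<lambda>_. c"]) simp
next
  case (Suc k)
  define c where "c = coeff p (Suc k) / 2 ^ Suc k"
  define q where "q = p - smult c (chebyshev_U (Suc k))"
  have "coeff q (Suc k) = 0"
    by (simp add: q_def c_def coeff_chebyshev_U)
  moreover have "degree q \<le> Suc k"
    unfolding q_def using Suc.prems degree_chebyshev_U_le[of "Suc k"]
    by (intro degree_diff_le) (auto intro: order_trans[OF degree_smult_le])
  ultimately have "degree q \<le> k"
    by (metis degree_0 le_SucE leading_coeff_0_iff zero_le)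
  then obtain a where a: "q = (\<Sum>l\<le>k. smult (a l) (chebyshev_U l))"
    using Suc.IH by blast
  have "(\<Sum>l\<le>k. smult ((a(Suc k := c)) l) (chebyshev_U l)) = q"
    unfolding a by (intro sum.cong) auto
  then have "p = (\<Sum>l\<le>Suc k. smult ((a(Suc k := c)) l) (chebyshev_U l))"
    by (simp add: q_def)
  then show ?case by blast
qed

section \<open>Exponential sums and exact quadrature at equally spaced angles\<close>

text \<open>A Dirichlet-type sum with frequencies k, k - 2, ..., -k. It also holds where the sine
  vanishes, because the proof follows the three-term recurrence and not the quotient of
  sines.\<close>

lemma chebU_cos_cis: "complex_of_real (chebU k (cos x)) = (\<Sum>l\<le>k. cis ((real k - 2 * real l) * x))"
proof -
  define D where "D k = (\<Sum>l\<le>k. cis ((real k - 2 * real l) * x))" for k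
  \<comment> \<open>Multiplication by \<open>cis x\<close> raises every frequency by one; only the
    new lowest frequency has to be added.\<close>
  have D_Suc: "D (Suc k) = cis x * D k + cis (- (real k + 1) * x)" for k
    by (simp add: D_def sum_distrib_left cis_mult algebra_simps)
  have c2: "complex_of_real (2 * cos x) = cis x + cis (- x)"
    by (simp add: complex_eq_iff)
  have "complex_of_real (chebU k (cos x)) = D k"
  proof (induction k rule: induct_nat_012)
    case 0
    then show ?case by (simp add: D_def)
  next
    case 1
    then show ?case using c2 by (simp add: D_def mult.commute)
  next
    case (ge2 k)
    have "complex_of_real (chebU (Suc (Suc k)) (cos x)) = (cis x + cis (- x)) * D (Suc k) - D k"
      unfolding c2[symmetric] using ge2 by (simp add: chebyshev_U_Suc_Suc)
    also have "cis (- x) * D (Suc k) = D k + cis (- (real (Suc k) + 1) * x)"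
      by (simp add: D_Suc distrib_left mult.assoc[symmetric] cis_mult)
        (rule arg_cong[where f = cis], simp add: algebra_simps)
    then have "(cis x + cis (- x)) * D (Suc k) - D k = D (Suc (Suc k))"
      by (simp add: D_Suc[of "Suc k"] distrib_right)
    finally show ?case .
  qed
  then show ?thesis by (simp add: D_def)
qed

text \<open>A geometric sum over the powers of an \<open>n\<close>-th root of unity
  \<open>z\<close>: either \<open>z = 1\<close>, or the sum vanishes because
  \<open>z ^ n = 1\<close>.\<close>

lemma sum_cis_roots_of_unity:
  assumes "n > 0"
  shows "(\<Sum>\<nu><n. cis (2 * pi * of_int j * real \<nu> / real n)) = (if int n dvd j then of_nat n else 0)"
proof -
  define z where "z = cis (2 * pi * of_int j / real n)"
  have zp: "cis (2 * pi * of_int j * real \<nu> / real n) = z ^ \<nu>" for \<nu>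
    unfolding z_def Complex.DeMoivre by (rule arg_cong[where f = cis]) simp
  have zn: "z ^ n = 1"
    using assms cis_multiple_2pi[of "of_int j"] by (simp add: z_def Complex.DeMoivre mult.commute)
  show ?thesis
  proof (cases "int n dvd j")
    case True
    then obtain i where "j = int n * i" by blast
    then have "z = cis (2 * pi * of_int i)" using assms by (simp add: z_def mult.assoc)
    then have "z = 1" using cis_multiple_2pi[of "of_int i"] by simp
    then show ?thesis using True by (simp add: zp)
  next
    case False
    have "z \<noteq> 1"
    proof
      assume "z = 1"
      then have "cos (2 * pi * of_int j / real n) = 1"
        unfolding z_def by (simp add: complex_eq_iff)
      then obtain i :: int where "2 * pi * of_int j / real n = of_int i * 2 * pi"
        using cos_one_2pi_int by blast
      then have "real_of_int j = of_int i * real n"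
        using assms by (simp add: field_simps)
      then have "real_of_int j = of_int (i * int n)" by simp
      then have "j = i * int n" by (simp only: of_int_eq_iff)
      then show False using False by simp
    qed
    then show ?thesis using False zn by (simp add: zp sum_gp_strict)
  qed
qed

text \<open>Multiplying out the two exponential sums leaves the frequency
  \<open>2 * (l - l')\<close> at the nodes. Summing over the nodes kills all but the diagonal terms,
  and these rebuild the expansion at \<open>\<alpha> - \<beta>\<close>.\<close>

lemma chebU_cos_quadrature:
  assumes "k \<le> 2 * m"
  shows "(\<Sum>\<nu>=0..2*m. chebU k (cos (\<alpha> - angle m \<nu>)) * chebU k (cos (angle m \<nu> - \<beta>)))
    = real (2 * m + 1) * chebU k (cos (\<alpha> - \<beta>))"
proof -
  define n where "n = 2 * m + 1"
  have set: "{0..2*m} = {..<n}" by (auto simp: n_def)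
  define e where "e l x = cis ((real k - 2 * real l) * x)" for l x
  have inner: "(\<Sum>\<nu><n. e l (\<alpha> - angle m \<nu>) * e l' (angle m \<nu> - \<beta>))
      = (if l = l' then of_nat n * e l (\<alpha> - \<beta>) else 0)" if "l \<le> k" "l' \<le> k" for l l'
  proof -
    define C where "C = cis ((real k - 2 * real l) * \<alpha> - (real k - 2 * real l') * \<beta>)"
    have "e l (\<alpha> - angle m \<nu>) * e l' (angle m \<nu> - \<beta>)
        = C * cis (2 * pi * of_int (2 * (int l - int l')) * real \<nu> / real n)" for \<nu>
    proof -
      have *: "2 * pi * of_int (2 * (int l - int l')) * real \<nu> / real n = angle m \<nu> * (2 * (real l - real l'))"
        by (simp add: angle_def n_def)
      show ?thesis
        unfolding e_def C_def cis_mult * by (intro arg_cong[where f = cis]) (simp add: algebra_simps)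
    qed
    then have "(\<Sum>\<nu><n. e l (\<alpha> - angle m \<nu>) * e l' (angle m \<nu> - \<beta>))
        = C * (if int n dvd 2 * (int l - int l') then of_nat n else 0)"
      using sum_cis_roots_of_unity[of n "2 * (int l - int l')"]
      by (simp add: sum_distrib_left[symmetric] n_def)
    \<comment> \<open>The number of nodes is odd, which removes the factor 2, and
      \<open>k \<le> 2 * m\<close> keeps the difference of the indices below
      \<open>n\<close>.\<close>
    moreover have "int n dvd 2 * (int l - int l') \<longleftrightarrow> l = l'"
    proof
      assume "int n dvd 2 * (int l - int l')"
      moreover have "coprime (int n) 2" by (simp add: n_def)
      ultimately have "int n dvd int l - int l'"
        using coprime_dvd_mult_right_iff by blast
      moreover have "\<bar>int l - int l'\<bar> < int n"
        using that assms by (auto simp: n_def)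
      ultimately show "l = l'"
        using zdvd_imp_le[of "int n" "\<bar>int l - int l'\<bar>"] by fastforce
    qed simp
    ultimately show ?thesis
      by (simp add: C_def e_def algebra_simps)
  qed
  have "complex_of_real (\<Sum>\<nu><n. chebU k (cos (\<alpha> - angle m \<nu>)) * chebU k (cos (angle m \<nu> - \<beta>)))
      = (\<Sum>\<nu><n. \<Sum>l\<le>k. \<Sum>l'\<le>k. e l (\<alpha> - angle m \<nu>) * e l' (angle m \<nu> - \<beta>))"
    by (simp add: chebU_cos_cis e_def sum_product)
  also have "\<dots> = (\<Sum>l\<le>k. \<Sum>l'\<le>k. \<Sum>\<nu><n. e l (\<alpha> - angle m \<nu>) * e l' (angle m \<nu> - \<beta>))"
    by (simp only: sum.swap[of _ "{..<n}"])
  also have "\<dots> = (\<Sum>l\<le>k. \<Sum>l'\<le>k. if l = l' then of_nat n * e l (\<alpha> - \<beta>) else 0)"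
    using inner by (intro sum.cong refl) auto
  also have "\<dots> = of_nat n * (\<Sum>l\<le>k. e l (\<alpha> - \<beta>))"
    by (simp add: sum_distrib_left)
  also have "\<dots> = complex_of_real (real n * chebU k (cos (\<alpha> - \<beta>)))"
    by (simp add: chebU_cos_cis e_def)
  finally show ?thesis unfolding set n_def[symmetric] using of_real_eq_iff by blast
qed

section \<open>Orthogonality for the weight \<open>sqrt (1 - t\<^sup>2)\<close>\<close>

text \<open>With an explicit antiderivative, the later substitution t = cos x becomes an application
  of the fundamental theorem of calculus. For \<open>a \<noteq> b\<close> it comes from the
  product-to-sum formula.\<close>

lemma sin_mult_sin_antiderivative:
  fixes a b :: nat
  assumes "a > 0" "b > 0"
  shows "\<exists>H. (\<forall>x. (H has_real_derivative sin (real a * x) * sin (real b * x)) (at x)) \<and>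
    H pi - H 0 = (if a = b then pi / 2 else 0)"
proof (cases "a = b")
  case True
  define H where "H x = x / 2 - sin (real a * x) * cos (real a * x) / (2 * real a)" for x
  have "(H has_real_derivative sin (real a * x) * sin (real b * x)) (at x)" for x
  proof -
    have "(H has_real_derivative (1 - (cos (real a * x))\<^sup>2 + (sin (real a * x))\<^sup>2) / 2) (at x)"
      unfolding H_def using assms
      by (auto intro!: derivative_eq_intros simp: field_simps power2_eq_square)
    moreover have "(1 - (cos (real a * x))\<^sup>2 + (sin (real a * x))\<^sup>2) / 2 = sin (real a * x) * sin (real b * x)"
      using sin_squared_eq[of "real b * x"] by (simp add: True power2_eq_square)
    ultimately show ?thesis by simp
  qed
  moreover have "H pi - H 0 = pi / 2"
    by (simp add: H_def)
  ultimately show ?thesis using True by auto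
next
  case False
  define c d where "c = real a - real b" and "d = real a + real b"
  have nz: "c \<noteq> 0" "d \<noteq> 0" using assms False by (auto simp: c_def d_def)
  define H where "H x = sin (c * x) / (2 * c) - sin (d * x) / (2 * d)" for x
  have "(H has_real_derivative sin (real a * x) * sin (real b * x)) (at x)" for x
  proof -
    have "(H has_real_derivative (cos (c * x) - cos (d * x)) / 2) (at x)"
      unfolding H_def using nz by (auto intro!: derivative_eq_intros simp: field_simps)
    moreover have "(cos (c * x) - cos (d * x)) / 2 = sin (real a * x) * sin (real b * x)"
      by (simp add: c_def d_def ring_distribs cos_add cos_diff)
    ultimately show ?thesis by simp
  qed
  moreover have "sin (c * pi) = 0" "sin (d * pi) = 0"
    by (simp_all add: c_def d_def left_diff_distrib distrib_right sin_diff sin_add)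
  then have "H pi - H 0 = 0"
    by (simp add: H_def)
  ultimately show ?thesis using False by auto
qed

text \<open>Under t = cos x the integrand becomes a product of two sines: the weight and the
  derivative of \<open>arccos\<close> absorb the two denominators \<open>sin x\<close>.\<close>

lemma has_integral_chebU_mult:
  "((\<lambda>t. sqrt (1 - t\<^sup>2) * (chebU k t * chebU l t)) has_integral (if k = l then pi / 2 else 0)) {-1..1}"
proof -
  obtain H where H: "\<And>x. (H has_real_derivative sin (real (k+1) * x) * sin (real (l+1) * x)) (at x)"
    and H_pi: "H pi - H 0 = (if k + 1 = l + 1 then pi / 2 else 0)"
    using sin_mult_sin_antiderivative[of "k+1" "l+1"] by auto
  have contH: "continuous_on UNIV H"
    using H by (meson DERIV_isCont continuous_at_imp_continuous_on)
  have "((\<lambda>t. sqrt (1 - t\<^sup>2) * (chebU k t * chebU l t)) has_integral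
      (- H (arccos 1) - (- H (arccos (-1))))) {-1..1}"
  \<comment> \<open>\<open>arccos\<close> is continuous but not differentiable at the end points, so
    derivatives are required in the interior only.\<close>
  proof (rule fundamental_theorem_of_calculus_interior)
    show "continuous_on {-1..1} (\<lambda>t. - H (arccos t))"
      by (intro continuous_intros continuous_on_compose2[OF contH]) auto
    fix t :: real assume t: "t \<in> {-1<..<1}"
    define \<theta> where "\<theta> = arccos t"
    have c: "cos \<theta> = t" and s: "sin \<theta> = sqrt (1 - t\<^sup>2)"
      using t by (auto simp: \<theta>_def sin_arccos)
    have "t\<^sup>2 < 1" using t by (auto simp: abs_square_less_1)
    then have nz: "sin \<theta> \<noteq> 0" by (simp add: s)
    have "((\<lambda>t. - H (arccos t)) has_real_derivative
        - (sin (real (k+1) * \<theta>) * sin (real (l+1) * \<theta>) * inverse (- sqrt (1 - t\<^sup>2)))) (at t)"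
      unfolding \<theta>_def using t
      by (intro DERIV_minus DERIV_chain2[OF H] DERIV_arccos) auto
    also have "- (sin (real (k+1) * \<theta>) * sin (real (l+1) * \<theta>) * inverse (- sqrt (1 - t\<^sup>2)))
        = sqrt (1 - t\<^sup>2) * (chebU k t * chebU l t)"
      unfolding s[symmetric] using nz poly_chebyshev_U_cos[OF nz, unfolded c]
      by (simp add: divide_simps mult_ac) (metis mult.commute mult.left_commute)
    finally show "((\<lambda>t. - H (arccos t)) has_vector_derivative
        sqrt (1 - t\<^sup>2) * (chebU k t * chebU l t)) (at t)"
      by (simp add: has_real_derivative_iff_has_vector_derivative)
  qed simp
  then show ?thesis using H_pi by simp
qed

text \<open>A linear functional of a single polynomial; the weighted inner product of
  \<open>p\<close> and \<open>q\<close> is its value at \<open>p * q\<close>.\<close>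

definition cheb_integral :: "real poly \<Rightarrow> real"
  where "cheb_integral p = integral {-1..1} (\<lambda>t. sqrt (1 - t\<^sup>2) * poly p t)"

lemma cheb_integral_sum: "cheb_integral (\<Sum>l\<in>A. smult (a l) (p l)) = (\<Sum>l\<in>A. a l * cheb_integral (p l))"
proof (cases "finite A")
  case True
  have "cheb_integral (\<Sum>l\<in>A. smult (a l) (p l))
      = integral {-1..1} (\<lambda>t. \<Sum>l\<in>A. a l * (sqrt (1 - t\<^sup>2) * poly (p l) t))"
    unfolding cheb_integral_def by (intro integral_cong) (simp add: poly_sum sum_distrib_left mult_ac)
  also have "\<dots> = (\<Sum>l\<in>A. integral {-1..1} (\<lambda>t. a l * (sqrt (1 - t\<^sup>2) * poly (p l) t)))"
    using True by (intro integral_sum integrable_continuous_real continuous_intros)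
  also have "\<dots> = (\<Sum>l\<in>A. a l * cheb_integral (p l))"
    by (simp add: cheb_integral_def)
  finally show ?thesis .
qed (simp add: cheb_integral_def)

lemma cheb_integral_U_U:
  "cheb_integral (chebyshev_U k * chebyshev_U l) = (if k = l then pi / 2 else 0)"
  unfolding cheb_integral_def poly_mult using has_integral_chebU_mult by (rule integral_unique)

lemma cheb_integral_expansion_U:
  "cheb_integral ((\<Sum>l\<le>k. smult (a l) (chebyshev_U l)) * chebyshev_U j) = (if j \<le> k then pi / 2 * a j else 0)"
  by (simp add: sum_distrib_right cheb_integral_sum cheb_integral_U_U if_distrib[of "(*) _"] cong: if_cong)

lemma cheb_integral_U_eq_0:
  assumes "degree p < k"
  shows "cheb_integral (p * chebyshev_U k) = 0"
proof -
  have "degree p \<le> k - 1" using assms by simp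
  then obtain a where "p = (\<Sum>l\<le>k-1. smult (a l) (chebyshev_U l))"
    using chebyshev_U_span by blast
  then show ?thesis using assms cheb_integral_expansion_U by simp
qed

text \<open>Orthogonality leaves only the \<open>chebyshev_U k\<close> term in the expansion of
  \<open>p\<close>, and its coefficient is read off at 1, where \<open>chebU k\<close> equals
  \<open>k + 1\<close>.\<close>

lemma cheb_integral_orthogonal_U:
  assumes "degree p \<le> k" "\<And>q. degree q < k \<Longrightarrow> cheb_integral (p * q) = 0"
  shows "cheb_integral (p * chebyshev_U k) = pi / (2 * real (k + 1)) * poly p 1"
proof -
  obtain a where a: "p = (\<Sum>l\<le>k. smult (a l) (chebyshev_U l))"
    using chebyshev_U_span[OF assms(1)] by blast
  have "a l = 0" if "l < k" for l
  proof -
    have "cheb_integral (p * chebyshev_U l) = 0"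
      using that degree_chebyshev_U_le[of l] by (intro assms(2)) simp
    then show ?thesis using that by (simp add: a cheb_integral_expansion_U)
  qed
  then have "(\<Sum>l\<le>k. smult (a l) (chebyshev_U l)) = (\<Sum>l\<in>{k}. smult (a l) (chebyshev_U l))"
    by (intro sum.mono_neutral_right) auto
  then have "poly p 1 = a k * real (k + 1)"
    by (simp add: a chebU_one)
  moreover have "cheb_integral (p * chebyshev_U k) = pi / 2 * a k"
    by (simp add: a cheb_integral_expansion_U)
  ultimately show ?thesis by (simp add: field_simps)
qed

section \<open>Rotations and the Radon projection\<close>

text \<open>Coordinates adapted to the direction \<open>\<theta>\<close>: the first is the signed
  distance of a chord from the origin, the second the position along the chord.\<close>

definition rot :: "real \<Rightarrow> real \<times> real \<Rightarrow> real \<times> real"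
  where "rot \<theta> = (\<lambda>(t, s). (t * cos \<theta> - s * sin \<theta>, t * sin \<theta> + s * cos \<theta>))"

lemma continuous_on_rot [continuous_intros]: "continuous_on A (rot \<theta>)"
  unfolding rot_def case_prod_unfold by (intro continuous_intros)

lemma rot_measurable [measurable]: "rot \<theta> \<in> borel_measurable borel"
  by (intro borel_measurable_continuous_onI continuous_on_rot)

text \<open>Fubini with \<open>y\<close> outermost: for fixed \<open>y\<close> the shear is a
  translation in \<open>x\<close>.\<close>

lemma distr_lborel_shear_fst:
  "distr lborel borel (\<lambda>(x, y). (x + a * y, y)) = (lborel :: (real \<times> real) measure)"
proof (rule measure_eqI)
  fix A :: "(real \<times> real) set" assume "A \<in> sets (distr lborel borel (\<lambda>(x, y). (x + a * y, y)))"
  then have A [measurable]: "A \<in> sets borel" by simp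
  have m: "(\<lambda>(x, y). (x + a * y, y)) \<in> borel_measurable (borel :: (real \<times> real) measure)"
    unfolding case_prod_unfold by (intro borel_measurable_continuous_onI continuous_intros)
  have "emeasure (distr lborel borel (\<lambda>(x, y). (x + a * y, y))) A
      = (\<integral>\<^sup>+p. indicator A (case p of (x, y) \<Rightarrow> (x + a * y, y)) \<partial>lborel)"
    using m by (simp add: nn_integral_distr flip: nn_integral_indicator)
  also have "\<dots> = (\<integral>\<^sup>+y. \<integral>\<^sup>+x. indicator A (x + a * y, y) \<partial>lborel \<partial>lborel)"
    using m unfolding lborel_prod[symmetric]
    by (subst lborel_pair.nn_integral_snd[symmetric]) (auto simp: lborel_prod case_prod_unfold)
  also have "\<dots> = (\<integral>\<^sup>+y. \<integral>\<^sup>+x. indicator A (x, y) \<partial>lborel \<partial>lborel)"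
  proof (rule nn_integral_cong)
    fix y :: real
    have "(\<integral>\<^sup>+x. indicator A (x, y) \<partial>lborel) = (\<integral>\<^sup>+x. indicator A (x, y) \<partial>distr lborel borel ((+) (a * y)))"
      by (simp only: lborel_distr_plus)
    also have "\<dots> = (\<integral>\<^sup>+x. indicator A (x + a * y, y) \<partial>lborel)"
      by (subst nn_integral_distr) (auto simp: add.commute)
    finally show "(\<integral>\<^sup>+x. indicator A (x + a * y, y) \<partial>lborel) = (\<integral>\<^sup>+x. indicator A (x, y) \<partial>lborel)" by simp
  qed
  also have "\<dots> = (\<integral>\<^sup>+p. indicator A p \<partial>(lborel \<Otimes>\<^sub>M lborel))"
    using A by (intro lborel_pair.nn_integral_snd) (simp add: lborel_prod)
  also have "\<dots> = emeasure lborel A"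
    unfolding lborel_prod using A by (intro nn_integral_indicator) simp
  finally show "emeasure (distr lborel borel (\<lambda>(x, y). (x + a * y, y))) A = emeasure lborel A" .
qed simp

lemma distr_lborel_swap: "distr lborel borel prod.swap = (lborel :: (real \<times> real) measure)"
proof -
  have "distr lborel borel prod.swap
      = distr (lborel \<Otimes>\<^sub>M lborel) (lborel \<Otimes>\<^sub>M lborel :: (real \<times> real) measure) (\<lambda>(x, y). (y, x))"
    unfolding lborel_prod by (intro distr_cong) (simp_all add: prod.swap_def case_prod_unfold)
  also have "\<dots> = lborel \<Otimes>\<^sub>M lborel"
    by (rule lborel_pair.distr_pair_swap[symmetric])
  finally show ?thesis by (simp only: lborel_prod)
qed

lemma distr_lborel_comp:
  fixes f g :: "'a::euclidean_space \<Rightarrow> 'a"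
  assumes "distr lborel borel f = lborel" "distr lborel borel g = lborel"
    and [measurable]: "f \<in> borel_measurable borel" "g \<in> borel_measurable borel"
  shows "distr lborel borel (f \<circ> g) = lborel"
proof -
  have "distr lborel borel (f \<circ> g) = distr (distr lborel borel g) borel f"
    by (subst distr_distr) auto
  then show ?thesis using assms(1,2) by simp
qed

text \<open>This is the first shear conjugated by the swap of coordinates.\<close>

lemma distr_lborel_shear_snd:
  "distr lborel borel (\<lambda>(x, y). (x, y + a * x)) = (lborel :: (real \<times> real) measure)"
proof -
  let ?h = "\<lambda>(x, y). (x + a * y, y) :: real \<times> real"
  have m [measurable]: "?h \<in> borel_measurable borel" "prod.swap \<in> borel_measurable (borel :: (real \<times> real) measure)"
    unfolding case_prod_unfold prod.swap_def by (intro borel_measurable_continuous_onI continuous_intros)+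
  have "(\<lambda>(x, y). (x, y + a * x)) = prod.swap \<circ> (?h \<circ> prod.swap)"
    by auto
  then show ?thesis
    by (simp only:) (intro distr_lborel_comp distr_lborel_shear_fst distr_lborel_swap m measurable_comp[OF m(2) m(1)])
qed

text \<open>A rotation by an angle that is not an odd multiple of \<open>\<pi>\<close> is a product of three shears; the
  remaining rotations are squares of such rotations.\<close>

lemma distr_lborel_rot: "distr lborel borel (rot \<theta>) = lborel"
proof -
  have main: "distr lborel borel (rot \<theta>) = lborel" if nz: "cos (\<theta> / 2) \<noteq> 0" for \<theta>
  proof -
    \<comment> \<open>Comparing the entries of the three-shear product with those of the rotation
      matrix forces this value; \<open>c\<close> and \<open>s\<close> below are the resulting
      equations.\<close>
    define u where "u = - tan (\<theta> / 2)"
    let ?f = "\<lambda>(x, y). (x + u * y, y) :: real \<times> real"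
    let ?g = "\<lambda>(x, y). (x, y + sin \<theta> * x) :: real \<times> real"
    have [measurable]: "?f \<in> borel_measurable borel" "?g \<in> borel_measurable borel"
      unfolding case_prod_unfold by (intro borel_measurable_continuous_onI continuous_intros)+
    have c: "cos \<theta> = 1 + u * sin \<theta>"
      using nz sin_double[of "\<theta> / 2"] cos_double_sin[of "\<theta> / 2"]
      by (simp add: u_def tan_def power2_eq_square)
    have s: "- sin \<theta> = u * (1 + cos \<theta>)"
      using nz sin_double[of "\<theta> / 2"] cos_double_cos[of "\<theta> / 2"]
      by (simp add: u_def tan_def power2_eq_square)
    have "rot \<theta> p = (?f \<circ> (?g \<circ> ?f)) p" for p
    proof (cases p)
      case (Pair x y)
      have "y * (- sin \<theta>) = y * (u * (1 + cos \<theta>))" by (simp only: s)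
      moreover have "x * cos \<theta> = x * (1 + u * sin \<theta>)" "y * cos \<theta> = y * (1 + u * sin \<theta>)"
        by (simp_all only: c)
      ultimately show ?thesis
        using c by (simp add: Pair rot_def algebra_simps)
    qed
    then have "rot \<theta> = ?f \<circ> (?g \<circ> ?f)" by blast
    then show ?thesis
      by (simp only:) (intro distr_lborel_comp distr_lborel_shear_fst distr_lborel_shear_snd; measurable)
  qed
  show ?thesis
  proof (cases "cos (\<theta> / 2) = 0")
    case True
    have "cos (\<theta> / 2) = 2 * (cos (\<theta> / 2 / 2))\<^sup>2 - 1"
      using cos_double_cos[of "\<theta> / 2 / 2"] by simp
    then have half: "distr lborel borel (rot (\<theta> / 2)) = lborel"
      using True by (intro main) auto
    have "rot \<theta> = rot (\<theta> / 2) \<circ> rot (\<theta> / 2)"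
    proof
      fix p :: "real \<times> real"
      show "rot \<theta> p = (rot (\<theta> / 2) \<circ> rot (\<theta> / 2)) p"
        using cos_add[of "\<theta> / 2" "\<theta> / 2"] sin_add[of "\<theta> / 2" "\<theta> / 2"]
        by (cases p) (simp add: rot_def right_diff_distrib left_diff_distrib distrib_left distrib_right mult_ac)
    qed
    then show ?thesis using half by (simp add: distr_lborel_comp)
  qed (rule main)
qed

section \<open>Fubini along the chords of the disk\<close>

text \<open>Rotations preserve the norm. The case \<open>\<bar>t\<bar> > 1\<close> is included:
  \<open>sqrt\<close> of a negative number is negative, so the interval is empty, just like the
  chord.\<close>

lemma rot_mem_B2: "rot \<theta> (t, s) \<in> B2 \<longleftrightarrow> s \<in> {- sqrt (1 - t\<^sup>2)..sqrt (1 - t\<^sup>2)}"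
proof -
  have "(t * cos \<theta> - s * sin \<theta>)\<^sup>2 + (t * sin \<theta> + s * cos \<theta>)\<^sup>2
      = (t\<^sup>2 + s\<^sup>2) * ((sin \<theta>)\<^sup>2 + (cos \<theta>)\<^sup>2)"
    by (simp only: power2_eq_square) algebra
  then have "rot \<theta> (t, s) \<in> B2 \<longleftrightarrow> s\<^sup>2 \<le> 1 - t\<^sup>2"
    by (auto simp: B2_def rot_def)
  also have "\<dots> \<longleftrightarrow> \<bar>s\<bar> \<le> sqrt (1 - t\<^sup>2)"
    by (metis real_sqrt_abs real_sqrt_le_iff)
  finally show ?thesis by auto
qed

text \<open>By completeness of Lebesgue measure, preimages that differ by a null set are measurable
  together.\<close>

lemma borel_measurable_lebesgue_AE:
  fixes f g :: "'a::euclidean_space \<Rightarrow> real"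
  assumes f: "f \<in> borel_measurable lebesgue" and ae: "AE x in lebesgue. f x = g x"
  shows "g \<in> borel_measurable lebesgue"
proof (rule measurableI)
  fix A :: "real set" assume "A \<in> sets borel"
  then have 1: "f -` A \<inter> space lebesgue \<in> sets lebesgue"
    using f by (rule measurable_sets[rotated])
  have 2: "AE x in lebesgue. x \<in> f -` A \<inter> space lebesgue \<longleftrightarrow> x \<in> g -` A \<inter> space lebesgue"
    using ae by eventually_elim auto
  show "g -` A \<inter> space lebesgue \<in> sets lebesgue"
    by (rule completion.in_sets_AE[OF 2 1]) simp
qed simp

text \<open>Planar \<open>lborel\<close> is a product measure, whereas planar
  \<open>lebesgue\<close> is not the product of its one-dimensional versions. So \<open>h\<close>,
  cut off outside the disk, is replaced by a Borel representative \<open>g\<close>; Fubini is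
  applied to \<open>g\<close> composed with the rotation, and the conclusions return to
  \<open>h\<close> almost everywhere.\<close>

lemma
  assumes "set_integrable lebesgue B2 h"
  shows AE_chord_integrable:
      "AE t in lebesgue. set_integrable lebesgue {- sqrt (1 - t\<^sup>2)..sqrt (1 - t\<^sup>2)} (chord_fun \<theta> h t)"
    and set_integrable_radon: "set_integrable lebesgue {-1..1} (radon \<theta> h)"
    and set_integral_radon: "(LINT t:{-1..1}|lebesgue. radon \<theta> h t) = (LINT p:B2|lebesgue. h p)"
proof -
  define H where "H p = indicat_real B2 p * h p" for p
  have H: "integrable lebesgue H"
    using assms by (simp add: set_integrable_def H_def[abs_def])
  then obtain g where g [measurable]: "g \<in> borel_measurable lborel" and "AE p in lborel. H p = g p"
    using completion_ex_borel_measurable_real[of H lborel] by auto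
  then have Hg: "AE p in lborel. H p = g p" by simp
  have "integrable lebesgue g"
    using H Hg by (subst integrable_cong_AE[of _ _ H]) (auto intro: AE_completion measurable_completion)
  then have g_int: "integrable lborel g" by (simp add: integrable_completion)
  have g_borel [measurable]: "g \<in> borel_measurable borel" using g by simp
  have gr_int: "integrable (lborel \<Otimes>\<^sub>M lborel) (\<lambda>p. g (rot \<theta> p))"
    using g_int unfolding lborel_prod
    by (subst (asm) distr_lborel_rot[of \<theta>, symmetric]) (simp add: integrable_distr_eq)
  \<comment> \<open>Rotation invariance keeps the exceptional set null, so almost every chord meets
    it in a null set.\<close>
  have "AE p in lborel. H (rot \<theta> p) = g (rot \<theta> p)"
  proof -
    have "AE p in distr lborel borel (rot \<theta>). H p = g p" using Hg by (subst distr_lborel_rot)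
    from AE_distrD[OF _ this] show ?thesis by simp
  qed
  then have AE1: "AE t in lborel. AE s in lborel. H (rot \<theta> (t, s)) = g (rot \<theta> (t, s))"
    unfolding lborel_prod[symmetric] by (rule lborel_pair.AE_pair)
  have AE2: "AE t in lborel. integrable lborel (\<lambda>s. g (rot \<theta> (t, s)))"
    using lborel_pair.AE_integrable_fst'[OF gr_int] .
  have H_rot: "indicator {- sqrt (1 - t\<^sup>2)..sqrt (1 - t\<^sup>2)} s *\<^sub>R chord_fun \<theta> h t s = H (rot \<theta> (t, s))" for t s
    using rot_mem_B2[of \<theta> t s] by (simp add: H_def chord_fun_def rot_def indicator_def)
  have key: "set_integrable lebesgue {- sqrt (1 - t\<^sup>2)..sqrt (1 - t\<^sup>2)} (chord_fun \<theta> h t)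
      \<and> radon \<theta> h t = (LINT s|lborel. g (rot \<theta> (t, s)))"
    if "AE s in lborel. H (rot \<theta> (t, s)) = g (rot \<theta> (t, s))" "integrable lborel (\<lambda>s. g (rot \<theta> (t, s)))" for t
  proof -
    have ae: "AE s in lebesgue. g (rot \<theta> (t, s)) = H (rot \<theta> (t, s))"
      using that(1) by (intro AE_completion) auto
    have gm: "(\<lambda>s. g (rot \<theta> (t, s))) \<in> borel_measurable lborel" by measurable
    have gm': "(\<lambda>s. g (rot \<theta> (t, s))) \<in> borel_measurable lebesgue"
      using gm by (rule measurable_completion)
    have Hm: "(\<lambda>s. H (rot \<theta> (t, s))) \<in> borel_measurable lebesgue"
      using gm' ae by (rule borel_measurable_lebesgue_AE)
    have "integrable lebesgue (\<lambda>s. g (rot \<theta> (t, s)))"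
      using that(2) gm by (simp add: integrable_completion)
    then have "integrable lebesgue (\<lambda>s. H (rot \<theta> (t, s)))"
      using integrable_cong_AE[OF gm' Hm ae] by blast
    moreover have "(LINT s|lebesgue. H (rot \<theta> (t, s))) = (LINT s|lborel. g (rot \<theta> (t, s)))"
      using integral_cong_AE[OF gm' Hm ae] gm by (simp add: integral_completion)
    ultimately show ?thesis
      unfolding set_integrable_def radon_def set_lebesgue_integral_def H_rot by blast
  qed
  from AE1 AE2 have AE3: "AE t in lborel. set_integrable lebesgue {- sqrt (1 - t\<^sup>2)..sqrt (1 - t\<^sup>2)} (chord_fun \<theta> h t)
      \<and> radon \<theta> h t = (LINT s|lborel. g (rot \<theta> (t, s)))"
    by eventually_elim (rule key)
  then show "AE t in lebesgue. set_integrable lebesgue {- sqrt (1 - t\<^sup>2)..sqrt (1 - t\<^sup>2)} (chord_fun \<theta> h t)"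
    by (intro AE_completion) auto
  \<comment> \<open>Off [-1,1] the interval of integration is empty, so integrating \<open>G\<close>
    over the whole line adds nothing.\<close>
  have radon_0: "radon \<theta> h t = 0" if "t \<notin> {-1..1}" for t
  proof -
    have "1 < \<bar>t\<bar>" using that by auto
    then have "1 < t\<^sup>2" by (metis one_less_power power2_abs zero_less_numeral)
    then have "{- sqrt (1 - t\<^sup>2)..sqrt (1 - t\<^sup>2)} = {}" by (auto simp: not_le)
    then show ?thesis by (simp add: radon_def set_lebesgue_integral_def)
  qed
  define G where "G t = (LINT s|lborel. g (rot \<theta> (t, s)))" for t
  have G: "integrable lborel G"
    using lborel_pair.integrable_fst'[OF gr_int] by (simp add: G_def[abs_def])
  have G': "integrable lebesgue G" using G by (simp add: integrable_completion)
  have ae: "AE t in lebesgue. G t = indicator {-1..1} t *\<^sub>R radon \<theta> h t"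
  proof (rule AE_completion)
    from AE3 show "AE t in lborel. G t = indicator {-1..1} t *\<^sub>R radon \<theta> h t"
    proof eventually_elim
      case (elim t)
      then show ?case
        using radon_0[of t] by (cases "t \<in> {-1..1}") (auto simp: G_def)
    qed
  qed
  have m: "(\<lambda>t. indicator {-1..1} t *\<^sub>R radon \<theta> h t) \<in> borel_measurable lebesgue"
    using borel_measurable_integrable[OF G'] ae by (rule borel_measurable_lebesgue_AE)
  show "set_integrable lebesgue {-1..1} (radon \<theta> h)"
    unfolding set_integrable_def using integrable_cong_AE[OF borel_measurable_integrable[OF G'] m ae] G' by blast
  have "(LINT t:{-1..1}|lebesgue. radon \<theta> h t) = (LINT t|lebesgue. G t)"
    unfolding set_lebesgue_integral_def using integral_cong_AE[OF borel_measurable_integrable[OF G'] m ae] by simp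
  also have "\<dots> = (LINT t|lborel. G t)" using G by (simp add: integral_completion)
  also have "\<dots> = (LINT p|lborel. g (rot \<theta> p))"
    unfolding G_def using lborel_pair.integral_fst'[OF gr_int] by (simp only: lborel_prod)
  also have "\<dots> = (LINT p|distr lborel borel (rot \<theta>). g p)"
    by (subst integral_distr) auto
  also have "\<dots> = (LINT p|lebesgue. g p)"
    by (simp add: distr_lborel_rot integral_completion)
  also have "\<dots> = (LINT p|lebesgue. H p)"
    using H Hg by (intro integral_cong_AE AE_completion) (auto intro: measurable_completion)
  finally show "(LINT t:{-1..1}|lebesgue. radon \<theta> h t) = (LINT p:B2|lebesgue. h p)"
    by (simp add: set_lebesgue_integral_def H_def)
qed

section \<open>Bivariate polynomials on the disk\<close>

lemma finite_poly2_index: "finite {(i, j). int (i + j) \<le> n}"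
  by (rule finite_subset[of _ "{..nat n} \<times> {..nat n}"]) auto

lemma poly2_upto_zero: "(\<lambda>_. 0) \<in> poly2_upto n"
  unfolding poly2_upto_def by (auto intro!: exI[of _ "\<lambda>_ _. 0"])

lemma poly2_upto_add:
  assumes "P \<in> poly2_upto n" "Q \<in> poly2_upto n"
  shows "(\<lambda>p. P p + Q p) \<in> poly2_upto n"
proof -
  obtain c d where
    "P = (\<lambda>(x, y). \<Sum>(i, j)\<in>{(i, j). int (i + j) \<le> n}. c i j * x ^ i * y ^ j)"
    "Q = (\<lambda>(x, y). \<Sum>(i, j)\<in>{(i, j). int (i + j) \<le> n}. d i j * x ^ i * y ^ j)"
    using assms unfolding poly2_upto_def by auto
  then have "(\<lambda>p. P p + Q p)
      = (\<lambda>(x, y). \<Sum>(i, j)\<in>{(i, j). int (i + j) \<le> n}. (c i j + d i j) * x ^ i * y ^ j)"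
    by (simp add: fun_eq_iff case_prod_unfold distrib_right sum.distrib)
  then show ?thesis
    unfolding poly2_upto_def by (intro CollectI exI[of _ "\<lambda>i j. c i j + d i j"])
qed

lemma poly2_upto_monomial:
  assumes "int (a + b) \<le> n"
  shows "(\<lambda>(x, y). c * x ^ a * y ^ b) \<in> poly2_upto n"
proof -
  have "(\<Sum>(i, j)\<in>{(i, j). int (i + j) \<le> n}. (if (i, j) = (a, b) then c else 0) * x ^ i * y ^ j)
      = c * x ^ a * y ^ b" for x y :: real
  proof -
    have "(\<Sum>(i, j)\<in>{(i, j). int (i + j) \<le> n}. (if (i, j) = (a, b) then c else 0) * x ^ i * y ^ j)
        = (\<Sum>q\<in>{(i, j). int (i + j) \<le> n}. if q = (a, b) then c * x ^ a * y ^ b else 0)"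
      by (intro sum.cong) (auto split: if_splits)
    then show ?thesis
      using finite_poly2_index[of n] assms by simp
  qed
  then show ?thesis
    unfolding poly2_upto_def by (intro CollectI exI[of _ "\<lambda>i j. if (i, j) = (a, b) then c else 0"]) simp
qed

text \<open>Reduces additive properties of polynomials to monomials, so that double sums need not be
  handled again.\<close>

lemma poly2_upto_induct [consumes 1, case_names zero add monomial]:
  assumes "P \<in> poly2_upto n"
    and zero: "R (\<lambda>_. 0)"
    and add: "\<And>P Q. R P \<Longrightarrow> R Q \<Longrightarrow> R (\<lambda>p. P p + Q p)"
    and monomial: "\<And>c i j. int (i + j) \<le> n \<Longrightarrow> R (\<lambda>(x, y). c * x ^ i * y ^ j)"
  shows "R P"
proof -
  obtain c where P: "P = (\<lambda>(x, y). \<Sum>(i, j)\<in>{(i, j). int (i + j) \<le> n}. c i j * x ^ i * y ^ j)"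
    using assms(1) unfolding poly2_upto_def by auto
  have "R (\<lambda>(x, y). \<Sum>(i, j)\<in>S. c i j * x ^ i * y ^ j)"
    if "finite S" "S \<subseteq> {(i, j). int (i + j) \<le> n}" for S
    using that
  proof (induction S)
    case empty
    then show ?case using zero by simp
  next
    case (insert q S)
    obtain i j where q: "q = (i, j)" by (cases q)
    have "R (\<lambda>p. (case p of (x, y) \<Rightarrow> c i j * x ^ i * y ^ j) +
        (case p of (x, y) \<Rightarrow> \<Sum>(i, j)\<in>S. c i j * x ^ i * y ^ j))"
      using insert q by (intro add monomial) auto
    then show ?case using insert.hyps by (simp add: q case_prod_unfold)
  qed
  from this[OF finite_poly2_index order_refl] show ?thesis unfolding P .
qed

lemma poly2_upto_cmult:
  assumes "P \<in> poly2_upto n"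
  shows "(\<lambda>p. a * P p) \<in> poly2_upto n"
  using assms
proof (induction rule: poly2_upto_induct)
  case (monomial c i j)
  then show ?case
    using poly2_upto_monomial[of i j n "a * c"] by (simp add: case_prod_unfold mult.assoc)
qed (auto simp: distrib_left poly2_upto_zero poly2_upto_add)

lemma poly2_upto_sum:
  assumes "\<And>i. i \<in> I \<Longrightarrow> P i \<in> poly2_upto n"
  shows "(\<lambda>p. \<Sum>i\<in>I. P i p) \<in> poly2_upto n"
  using assms by (induction I rule: infinite_finite_induct) (auto intro: poly2_upto_zero poly2_upto_add)

lemma poly2_upto_diff:
  assumes "P \<in> poly2_upto n" "Q \<in> poly2_upto n"
  shows "(\<lambda>p. P p - Q p) \<in> poly2_upto n"
  using poly2_upto_add[OF assms(1) poly2_upto_cmult[OF assms(2), of "-1"]] by simp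

lemma poly2_upto_mono:
  assumes "P \<in> poly2_upto a" "a \<le> b"
  shows "P \<in> poly2_upto b"
  using assms(1)
proof (induction rule: poly2_upto_induct)
  case (monomial c i j)
  then show ?case using assms(2) by (intro poly2_upto_monomial) simp
qed (auto intro: poly2_upto_zero poly2_upto_add)

lemma poly2_upto_mult:
  assumes "P \<in> poly2_upto a" "Q \<in> poly2_upto b"
  shows "(\<lambda>p. P p * Q p) \<in> poly2_upto (a + b)"
  using assms(1)
proof (induction rule: poly2_upto_induct)
  case (monomial c i j)
  note ij = this
  show ?case
    using assms(2)
  proof (induction rule: poly2_upto_induct)
    case (monomial d k l)
    then show ?case
      using ij poly2_upto_monomial[of "i + k" "j + l" "a + b" "c * d"]
      by (simp add: case_prod_unfold power_add mult_ac)
  qed (auto simp: distrib_left poly2_upto_zero poly2_upto_add)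
qed (auto simp: distrib_right poly2_upto_zero poly2_upto_add)

lemma poly2_upto_power:
  assumes "P \<in> poly2_upto 1"
  shows "(\<lambda>p. P p ^ i) \<in> poly2_upto (int i)"
proof (induction i)
  case 0
  then show ?case using poly2_upto_monomial[of 0 0 0 1] by (simp add: case_prod_unfold)
next
  case (Suc i)
  then show ?case using poly2_upto_mult[OF assms Suc] by simp
qed

lemma poly2_upto_linear: "(\<lambda>(x, y). a * x + b * y) \<in> poly2_upto 1"
  using poly2_upto_add[OF poly2_upto_monomial[of 1 0 1 a] poly2_upto_monomial[of 0 1 1 b]]
  by (simp add: case_prod_unfold)

text \<open>Both coordinates of \<open>rot\<close> are linear forms, so composition does not raise
  the degree.\<close>

lemma poly2_upto_rot:
  assumes "P \<in> poly2_upto n"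
  shows "(\<lambda>p. P (rot \<theta> p)) \<in> poly2_upto n"
  using assms
proof (induction rule: poly2_upto_induct)
  case (monomial c i j)
  have "(\<lambda>p. c * ((\<lambda>(x, y). cos \<theta> * x + (- sin \<theta>) * y) p ^ i * (\<lambda>(x, y). sin \<theta> * x + cos \<theta> * y) p ^ j))
      \<in> poly2_upto (int i + int j)"
    by (intro poly2_upto_cmult poly2_upto_mult poly2_upto_power poly2_upto_linear)
  then have "(\<lambda>p. c * ((\<lambda>(x, y). cos \<theta> * x + (- sin \<theta>) * y) p ^ i * (\<lambda>(x, y). sin \<theta> * x + cos \<theta> * y) p ^ j))
      \<in> poly2_upto n"
    by (rule poly2_upto_mono) (use monomial in simp)
  then show ?case by (simp add: rot_def case_prod_unfold mult_ac)
qed (auto intro: poly2_upto_zero poly2_upto_add)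

text \<open>Unlike in \<open>ridge_U\<close>, the profile is an arbitrary polynomial: powers of
  linear forms and the profile of \<open>Phi\<close> occur as well.\<close>

definition ridge :: "real poly \<Rightarrow> real \<Rightarrow> real \<times> real \<Rightarrow> real"
  where "ridge q \<theta> = (\<lambda>(x, y). poly q (x * cos \<theta> + y * sin \<theta>))"

lemma poly2_upto_ridge: "ridge q \<theta> \<in> poly2_upto (int (degree q))"
proof -
  have "ridge q \<theta> = (\<lambda>p. \<Sum>i\<le>degree q. coeff q i * (\<lambda>(x, y). cos \<theta> * x + sin \<theta> * y) p ^ i)"
    by (simp add: ridge_def poly_altdef case_prod_unfold mult.commute)
  also have "\<dots> \<in> poly2_upto (int (degree q))"
    by (intro poly2_upto_sum poly2_upto_cmult poly2_upto_mono[OF poly2_upto_power[OF poly2_upto_linear]]) auto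
  finally show ?thesis .
qed

lemma ridge_sum: "ridge (\<Sum>l\<in>A. smult (a l) (p l)) \<theta> = (\<lambda>z. \<Sum>l\<in>A. a l * ridge (p l) \<theta> z)"
  by (auto simp: ridge_def poly_sum)

lemma continuous_on_poly2:
  assumes "P \<in> poly2_upto n"
  shows "continuous_on A P"
  using assms
  by (induction rule: poly2_upto_induct) (auto intro!: continuous_intros simp: case_prod_unfold)

text \<open>Restriction to lines through the origin makes root counting in one variable
  available.\<close>

lemma poly2_upto_line:
  assumes "P \<in> poly2_upto n"
  shows "\<exists>q. \<forall>r. poly q r = P (r * x, r * y)"
  using assms
proof (induction rule: poly2_upto_induct)
  case zero
  then show ?case by (intro exI[of _ 0]) simp
next
  case (add P Q)
  then obtain p q where "\<forall>r. poly p r = P (r * x, r * y)" "\<forall>r. poly q r = Q (r * x, r * y)" by blast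
  then show ?case by (intro exI[of _ "p + q"]) simp
next
  case (monomial c i j)
  then show ?case
    by (intro exI[of _ "monom (c * x ^ i * y ^ j) (i + j)"])
      (simp add: poly_monom power_add power_mult_distrib)
qed

lemma poly2_upto_neg: "n < 0 \<Longrightarrow> P \<in> poly2_upto n \<Longrightarrow> P = (\<lambda>_. 0)"
proof -
  assume "n < 0" "P \<in> poly2_upto n"
  moreover from \<open>n < 0\<close> have "{(i, j). int (i + j) \<le> n} = {}" by auto
  ultimately show "P = (\<lambda>_. 0)" by (auto simp: poly2_upto_def)
qed

section \<open>Pairing functions with polynomials on the disk\<close>

lemma compact_B2: "compact B2"
proof -
  have "B2 = cball 0 1"
    by (auto simp: B2_def norm_Pair dist_norm real_sqrt_le_1_iff)
  then show ?thesis by (metis compact_cball)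
qed

lemma B2_sets_lebesgue: "B2 \<in> sets lebesgue"
  using compact_B2 by (simp add: compact_imp_closed borel_closed)

text \<open>A common setting for members of \<open>L2_disk\<close> and for polynomials, with just
  the integrability that makes \<open>inner_disk\<close> additive. Taking \<open>P\<close> constant
  shows that \<open>f\<close> itself is integrable on the disk.\<close>

definition disk_pairable :: "(real \<times> real \<Rightarrow> real) \<Rightarrow> bool"
  where "disk_pairable f \<longleftrightarrow>
    (\<forall>P. continuous_on UNIV P \<longrightarrow> set_integrable lebesgue B2 (\<lambda>p. f p * P p))"

lemma set_integrable_B2_continuous:
  fixes P :: "real \<times> real \<Rightarrow> real"
  assumes "continuous_on UNIV P"
  shows "set_integrable lebesgue B2 P"
proof -
  have "integrable lborel (\<lambda>p. indicator B2 p *\<^sub>R P p)"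
    using compact_B2 assms continuous_on_subset by (intro borel_integrable_compact) auto
  then show ?thesis
    unfolding set_integrable_def by (subst integrable_completion) auto
qed

lemma disk_pairable_continuous: "continuous_on UNIV f \<Longrightarrow> disk_pairable f"
  unfolding disk_pairable_def by (auto intro!: set_integrable_B2_continuous continuous_intros)

lemma disk_pairable_poly2: "P \<in> poly2_upto n \<Longrightarrow> disk_pairable P"
  by (intro disk_pairable_continuous continuous_on_poly2)

text \<open>The product is dominated by the sum of the two squares, and a continuous function is
  square integrable on the compact disk.\<close>

lemma disk_pairable_L2:
  assumes "f \<in> L2_disk"
  shows "disk_pairable f"
  unfolding disk_pairable_def
proof (intro allI impI)
  fix P :: "real \<times> real \<Rightarrow> real" assume P: "continuous_on UNIV P"
  have fm [measurable]: "f \<in> borel_measurable (lebesgue_on B2)"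
    and f2: "integrable (lebesgue_on B2) (\<lambda>p. (f p)\<^sup>2)"
    using assms by (auto simp: L2_disk_def)
  have Pm [measurable]: "P \<in> borel_measurable (lebesgue_on B2)"
    using P B2_sets_lebesgue by (intro continuous_imp_measurable_on_sets_lebesgue) (auto intro: continuous_on_subset)
  have "set_integrable lebesgue B2 (\<lambda>p. (P p)\<^sup>2)"
    using P by (intro set_integrable_B2_continuous continuous_intros)
  then have "integrable (lebesgue_on B2) (\<lambda>p. (P p)\<^sup>2)"
    using B2_sets_lebesgue by (simp add: integrable_restrict_space set_integrable_def)
  with f2 have "integrable (lebesgue_on B2) (\<lambda>p. (f p)\<^sup>2 + (P p)\<^sup>2)"
    by (rule Bochner_Integration.integrable_add)
  then have "integrable (lebesgue_on B2) (\<lambda>p. f p * P p)"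
  proof (rule Bochner_Integration.integrable_bound)
    have "\<bar>f p * P p\<bar> \<le> (f p)\<^sup>2 + (P p)\<^sup>2" for p
    proof -
      have "0 \<le> (\<bar>f p\<bar> - \<bar>P p\<bar>)\<^sup>2" by simp
      then have "2 * (\<bar>f p\<bar> * \<bar>P p\<bar>) \<le> (f p)\<^sup>2 + (P p)\<^sup>2"
        by (simp add: power2_eq_square algebra_simps)
      moreover have "0 \<le> \<bar>f p\<bar> * \<bar>P p\<bar>" by simp
      ultimately show ?thesis unfolding abs_mult by linarith
    qed
    then show "AE p in lebesgue_on B2. norm (f p * P p) \<le> norm ((f p)\<^sup>2 + (P p)\<^sup>2)"
      by (auto intro!: AE_I2 order_trans[OF _ abs_ge_self])
  qed measurable
  then show "set_integrable lebesgue B2 (\<lambda>p. f p * P p)"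
    using B2_sets_lebesgue by (simp add: integrable_restrict_space set_integrable_def)
qed

lemma disk_pairableD:
  "disk_pairable f \<Longrightarrow> P \<in> poly2_upto n \<Longrightarrow> set_integrable lebesgue B2 (\<lambda>p. f p * P p)"
  unfolding disk_pairable_def using continuous_on_poly2 by blast

lemma inner_disk_commute: "inner_disk f g = inner_disk g f"
  by (simp add: inner_disk_def mult.commute)

lemma inner_disk_zero_right [simp]: "inner_disk f (\<lambda>_. 0) = 0"
  by (simp add: inner_disk_def set_lebesgue_integral_def)

lemma inner_disk_cmult_right: "inner_disk f (\<lambda>p. a * g p) = a * inner_disk f g"
  by (simp add: inner_disk_def mult.left_commute)

lemma inner_disk_add_right:
  assumes "disk_pairable f" "P \<in> poly2_upto n" "Q \<in> poly2_upto n"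
  shows "inner_disk f (\<lambda>p. P p + Q p) = inner_disk f P + inner_disk f Q"
  unfolding inner_disk_def distrib_left
  using assms by (intro set_integral_add disk_pairableD)

lemma inner_disk_sum_right:
  assumes "disk_pairable f" "\<And>i. i \<in> I \<Longrightarrow> P i \<in> poly2_upto n"
  shows "inner_disk f (\<lambda>p. \<Sum>i\<in>I. a i * P i p) = (\<Sum>i\<in>I. a i * inner_disk f (P i))"
  using assms(2)
proof (induction I rule: infinite_finite_induct)
  case (insert i I)
  have "inner_disk f (\<lambda>p. a i * P i p + (\<Sum>i\<in>I. a i * P i p))
      = inner_disk f (\<lambda>p. a i * P i p) + inner_disk f (\<lambda>p. \<Sum>i\<in>I. a i * P i p)"
    using insert.prems assms(1)
    by (intro inner_disk_add_right[where n = n] poly2_upto_cmult poly2_upto_sum) auto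
  then show ?case using insert by (simp add: inner_disk_cmult_right)
qed auto

lemma inner_disk_diff_left:
  assumes "disk_pairable f" "disk_pairable g" "Q \<in> poly2_upto n"
  shows "inner_disk (\<lambda>p. f p - g p) Q = inner_disk f Q - inner_disk g Q"
  unfolding inner_disk_def left_diff_distrib
  using assms by (intro set_integral_diff disk_pairableD)

text \<open>The points of the open unit ball where \<open>P\<close> is nonzero form an open
  negligible set, hence none exist. As \<open>P\<close> is a function on the whole plane, its
  vanishing is then propagated along each ray from the origin.\<close>

lemma inner_disk_self_eq_0:
  assumes P: "P \<in> poly2_upto n" and 0: "inner_disk P P = 0"
  shows "P = (\<lambda>_. 0)"
proof -
  have cont: "continuous_on A P" for A using P by (rule continuous_on_poly2)
  have "integrable lebesgue (\<lambda>p. indicator B2 p *\<^sub>R (P p * P p))"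
    using disk_pairableD[OF disk_pairable_poly2[OF P] P] by (simp add: set_integrable_def)
  then have "AE p in lebesgue. indicator B2 p *\<^sub>R (P p * P p) = 0"
    using 0 unfolding inner_disk_def set_lebesgue_integral_def
    by (subst (asm) integral_nonneg_eq_0_iff_AE) auto
  then have "{p. indicator B2 p *\<^sub>R (P p * P p) \<noteq> 0} \<in> null_sets lebesgue"
    by (simp add: completion.AE_iff_null_sets)
  then have "negligible {p. indicator B2 p *\<^sub>R (P p * P p) \<noteq> 0}"
    by (simp add: negligible_iff_null_sets)
  moreover define U where "U = {p \<in> ball 0 1. P p \<noteq> 0}"
  have "U \<subseteq> {p. indicator B2 p *\<^sub>R (P p * P p) \<noteq> 0}"
    by (auto simp: U_def B2_def indicator_def norm_Pair)
  ultimately have "negligible U" by (rule negligible_subset)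
  moreover have "open U"
  proof -
    have "U = ball 0 1 \<inter> P -` (- {0})" by (auto simp: U_def)
    then show ?thesis using cont by (simp add: continuous_open_preimage open_Compl)
  qed
  ultimately have U: "U = {}" using open_not_negligible by blast
  show ?thesis
  proof
    fix z :: "real \<times> real"
    obtain x y where z: "z = (x, y)" by (cases z)
    obtain q where q: "\<And>r. poly q r = P (r * x, r * y)" using poly2_upto_line[OF P] by blast
    \<comment> \<open>For \<open>0 < r < e\<close> the point \<open>r *\<^sub>R z\<close> lies in
      the open unit ball; the summand 1 covers \<open>z = 0\<close>.\<close>
    define e where "e = 1 / (norm z + 1)"
    have "e > 0" by (simp add: e_def add_nonneg_pos)
    then have "q = 0"
    proof (rule poly_eqI_Ioo)
      fix r assume r: "r \<in> {0<..<e}"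
      have "norm (r *\<^sub>R z) = r * norm z" using r by simp
      also have "\<dots> \<le> e * norm z" using r by (intro mult_right_mono) auto
      also have "\<dots> < 1" by (simp add: e_def add_nonneg_pos divide_less_eq)
      finally have "r *\<^sub>R z \<in> ball 0 1" by simp
      moreover have "r *\<^sub>R z \<notin> U" using U by blast
      ultimately have "P (r *\<^sub>R z) = 0" by (simp only: U_def) simp
      then show "poly q r = poly 0 r" by (simp add: q z)
    qed
    then show "P z = 0" using q[of 1] by (simp add: z)
  qed
qed

section \<open>Orthogonal polynomials and the projection\<close>

text \<open>A ridge function is constant on each chord orthogonal to its direction. The identity
  holds at every \<open>t\<close>, also where the chord integral has its default value 0.\<close>

lemma radon_mult_ridge:
  "radon \<theta> (\<lambda>p. f p * ridge q \<theta> p) t = radon \<theta> f t * poly q t"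
proof -
  have "(t * cos \<theta> - s * sin \<theta>) * cos \<theta> + (t * sin \<theta> + s * cos \<theta>) * sin \<theta>
      = t * ((sin \<theta>)\<^sup>2 + (cos \<theta>)\<^sup>2)" for s
    by (simp only: power2_eq_square) algebra
  then have "chord_fun \<theta> (\<lambda>p. f p * ridge q \<theta> p) t s = chord_fun \<theta> f t s * poly q t" for s
    by (simp add: chord_fun_def ridge_def)
  then show ?thesis by (simp add: radon_def)
qed

text \<open>Forming ridge functions is adjoint to the Radon projection.\<close>

lemma
  assumes "disk_pairable f"
  shows radon_ridge_integrable: "set_integrable lebesgue {-1..1} (\<lambda>t. radon \<theta> f t * poly q t)"
    and inner_disk_ridge: "inner_disk f (ridge q \<theta>) = (LINT t:{-1..1}|lebesgue. radon \<theta> f t * poly q t)"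
proof -
  note * = disk_pairableD[OF assms poly2_upto_ridge, of q \<theta>]
  show "set_integrable lebesgue {-1..1} (\<lambda>t. radon \<theta> f t * poly q t)"
    using set_integrable_radon[OF *, of \<theta>] by (simp only: radon_mult_ridge[THEN ext])
  show "inner_disk f (ridge q \<theta>) = (LINT t:{-1..1}|lebesgue. radon \<theta> f t * poly q t)"
    using set_integral_radon[OF *, of \<theta>] by (simp add: radon_mult_ridge inner_disk_def)
qed

text \<open>Odd powers of \<open>s\<close> integrate to 0, and an even power gives an odd power of
  \<open>sqrt (1 - t\<^sup>2)\<close>, that is, one root times a polynomial in \<open>t\<close>. As
  \<open>t\<close> tends to 1 the chord shrinks to the point (1, 0) while its length is twice the
  root, whence the value of \<open>G\<close> at 1.\<close>

lemma chord_integral_poly2: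
  assumes "P \<in> poly2_upto (int k)"
  shows "\<exists>G. degree G \<le> k \<and> poly G 1 = 2 * P (1, 0) \<and>
    (\<forall>t\<in>{-1..1}. ((\<lambda>s. P (t, s)) has_integral sqrt (1 - t\<^sup>2) * poly G t) {- sqrt (1 - t\<^sup>2)..sqrt (1 - t\<^sup>2)})"
  using assms
proof (induction rule: poly2_upto_induct)
  case zero
  then show ?case by (intro exI[of _ 0]) auto
next
  case (add P Q)
  then obtain G H where "degree G \<le> k" "poly G 1 = 2 * P (1, 0)" "degree H \<le> k" "poly H 1 = 2 * Q (1, 0)"
    "\<forall>t\<in>{-1..1}. ((\<lambda>s. P (t, s)) has_integral sqrt (1 - t\<^sup>2) * poly G t) {- sqrt (1 - t\<^sup>2)..sqrt (1 - t\<^sup>2)}"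
    "\<forall>t\<in>{-1..1}. ((\<lambda>s. Q (t, s)) has_integral sqrt (1 - t\<^sup>2) * poly H t) {- sqrt (1 - t\<^sup>2)..sqrt (1 - t\<^sup>2)}"
    by blast
  then show ?case
    by (intro exI[of _ "G + H"]) (auto simp: distrib_left intro!: degree_add_le has_integral_add)
next
  case (monomial c i j)
  have base: "((\<lambda>s. c * t ^ i * s ^ j) has_integral
      c * t ^ i * (r ^ Suc j / real (Suc j) - (- r) ^ Suc j / real (Suc j))) {- r..r}"
    if "r \<ge> 0" for t r :: real
  proof (intro has_integral_mult_right fundamental_theorem_of_calculus)
    show "((\<lambda>s. s ^ Suc j / real (Suc j)) has_vector_derivative s ^ j) (at s within {- r..r})" for s :: real
    proof -
      have "((\<lambda>s. s ^ Suc j / real (Suc j)) has_real_derivative real (Suc j) * s ^ j / real (Suc j)) (at s within {- r..r})"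
        using DERIV_pow[of "Suc j" s "{- r..r}"] by (intro DERIV_cdivide) simp
      then show ?thesis by (simp add: has_real_derivative_iff_has_vector_derivative)
    qed
  qed (use that in auto)
  show ?case
  proof (cases "even j")
    case False
    have "((\<lambda>s. c * t ^ i * s ^ j) has_integral sqrt (1 - t\<^sup>2) * poly 0 t) {- sqrt (1 - t\<^sup>2)..sqrt (1 - t\<^sup>2)}"
      if "t \<in> {-1..1}" for t
      using base[of "sqrt (1 - t\<^sup>2)" t] that False by (simp add: abs_square_le_1 abs_le_iff)
    then show ?thesis using False by (intro exI[of _ 0]) (auto simp: power_0_left)
  next
    case True
    then obtain l where l: "j = 2 * l" by (elim evenE)
    define G where "G = smult (2 * c / real (Suc j)) (monom 1 i * [:1, 0, -1:] ^ l)"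
    have "degree G \<le> i + 2 * l"
    proof -
      have "degree ([:1, 0, -1:] ^ l :: real poly) \<le> 2 * l"
        using degree_power_le[of "[:1, 0, -1::real:]" l] by simp
      then have "degree (monom 1 i * [:1, 0, -1:] ^ l :: real poly) \<le> i + 2 * l"
        by (intro order_trans[OF degree_mult_le] add_mono degree_monom_le)
      then show ?thesis unfolding G_def by (intro order_trans[OF degree_smult_le])
    qed
    then have "degree G \<le> k" using monomial l by simp
    moreover have "poly G 1 = 2 * (case (1, 0) of (x, y) \<Rightarrow> c * x ^ i * y ^ j)"
      by (simp add: G_def poly_monom l power_0_left)
    moreover have "((\<lambda>s. c * t ^ i * s ^ j) has_integral sqrt (1 - t\<^sup>2) * poly G t) {- sqrt (1 - t\<^sup>2)..sqrt (1 - t\<^sup>2)}"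
      if t: "t \<in> {-1..1}" for t
    proof -
      define r where "r = sqrt (1 - t\<^sup>2)"
      have "t\<^sup>2 \<le> 1" using t by (simp add: abs_square_le_1 abs_le_iff)
      then have r: "r \<ge> 0" "r ^ j = (1 - t\<^sup>2) ^ l"
        by (simp_all add: r_def l power_mult)
      have "poly [:1, 0, -1:] t = 1 - t\<^sup>2" by (simp add: power2_eq_square)
      then have "c * t ^ i * (r ^ Suc j / real (Suc j) - (- r) ^ Suc j / real (Suc j)) = r * poly G t"
        using True r(2) by (simp add: G_def poly_monom poly_power)
      then show ?thesis using base[OF r(1), of t] unfolding r_def[symmetric] by simp
    qed
    ultimately show ?thesis by (intro exI[of _ G]) auto
  qed
qed

text \<open>Rotating \<open>P\<close> reduces the direction \<open>\<theta>\<close> to vertical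
  chords, and \<open>rot \<theta> (1, 0)\<close> is the boundary point at angle
  \<open>\<theta>\<close>.\<close>

lemma radon_poly2:
  assumes "P \<in> poly2_upto (int k)"
  obtains G where "degree G \<le> k" "poly G 1 = 2 * P (cos \<theta>, sin \<theta>)"
    "\<And>q. inner_disk P (ridge q \<theta>) = cheb_integral (G * q)"
proof -
  obtain G where G: "degree G \<le> k" "poly G 1 = 2 * P (rot \<theta> (1, 0))" and
    int: "\<forall>t\<in>{-1..1}. ((\<lambda>s. P (rot \<theta> (t, s))) has_integral sqrt (1 - t\<^sup>2) * poly G t)
      {- sqrt (1 - t\<^sup>2)..sqrt (1 - t\<^sup>2)}"
    using chord_integral_poly2[OF poly2_upto_rot[OF assms, of \<theta>]] by blast
  have radon: "radon \<theta> P t = sqrt (1 - t\<^sup>2) * poly G t" if t: "t \<in> {-1..1}" for t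
  proof -
    have "continuous_on UNIV (\<lambda>s. P (rot \<theta> (t, s)))"
      by (intro continuous_on_compose2[OF continuous_on_poly2[OF assms, of UNIV]]
          continuous_on_compose2[OF continuous_on_rot[of UNIV]] continuous_intros) auto
    then have "set_integrable lebesgue {- sqrt (1 - t\<^sup>2)..sqrt (1 - t\<^sup>2)} (\<lambda>s. P (rot \<theta> (t, s)))"
      by (intro absolutely_integrable_continuous_real) (auto intro: continuous_on_subset)
    then have "radon \<theta> P t = integral {- sqrt (1 - t\<^sup>2)..sqrt (1 - t\<^sup>2)} (\<lambda>s. P (rot \<theta> (t, s)))"
      by (simp add: radon_def chord_fun_def rot_def set_lebesgue_integral_eq_integral)
    then show ?thesis using int t integral_unique by metis
  qed
  have "inner_disk P (ridge q \<theta>) = cheb_integral (G * q)" for q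
  proof -
    have "inner_disk P (ridge q \<theta>) = integral {-1..1} (\<lambda>t. radon \<theta> P t * poly q t)"
      using disk_pairable_poly2[OF assms]
      by (simp add: inner_disk_ridge set_lebesgue_integral_eq_integral radon_ridge_integrable)
    also have "\<dots> = cheb_integral (G * q)"
      unfolding cheb_integral_def by (intro integral_cong) (simp add: radon)
    finally show ?thesis .
  qed
  with G show ?thesis by (intro that[of G]) (auto simp: rot_def)
qed

section \<open>The spaces of orthogonal polynomials\<close>

text \<open>A polynomial of lower degree that satisfies the orthogonality condition is orthogonal to
  itself, hence zero. In this form the space is visibly linear.\<close>

lemma orth_poly_space_alt:
  "orth_poly_space k =
    {P \<in> poly2_upto (int k). \<forall>Q \<in> poly2_upto (int k - 1). inner_disk P Q = 0}"
proof -
  have "inner_disk (\<lambda>_. 0) Q = 0" for Q by (simp add: inner_disk_commute[of _ Q])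
  then show ?thesis
    unfolding orth_poly_space_def using inner_disk_self_eq_0 poly2_upto_zero by blast
qed

lemma orth_poly_space_sum:
  assumes "\<And>i. i \<in> I \<Longrightarrow> P i \<in> orth_poly_space k"
  shows "(\<lambda>p. \<Sum>i\<in>I. a i * P i p) \<in> orth_poly_space k"
proof -
  have "inner_disk (\<lambda>p. \<Sum>i\<in>I. a i * P i p) Q = 0" if "Q \<in> poly2_upto (int k - 1)" for Q
  proof -
    have "inner_disk Q (\<lambda>p. \<Sum>i\<in>I. a i * P i p) = (\<Sum>i\<in>I. a i * inner_disk Q (P i))"
      using assms by (intro inner_disk_sum_right[OF disk_pairable_poly2[OF that], of I P "int k"])
        (auto simp: orth_poly_space_alt)
    also have "\<dots> = 0"
      using assms that by (intro sum.neutral) (auto simp: orth_poly_space_alt inner_disk_commute[of Q])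
    finally show ?thesis by (simp only: inner_disk_commute)
  qed
  then show ?thesis
    using assms by (auto simp: orth_poly_space_alt intro!: poly2_upto_sum poly2_upto_cmult)
qed

lemma orth_poly_space_diff:
  assumes "P \<in> orth_poly_space k" "Q \<in> orth_poly_space k"
  shows "(\<lambda>p. P p - Q p) \<in> orth_poly_space k"
  using assms
  by (auto simp: orth_poly_space_alt poly2_upto_diff inner_disk_diff_left disk_pairable_poly2)

abbreviation ridge_cheb :: "nat \<Rightarrow> real \<Rightarrow> real \<times> real \<Rightarrow> real"
  where "ridge_cheb k \<equiv> ridge (chebyshev_U k)"

lemma ridge_cheb_circle: "ridge_cheb k \<theta> (cos \<alpha>, sin \<alpha>) = chebU k (cos (\<alpha> - \<theta>))"
  by (simp add: ridge_def cos_diff)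

text \<open>Pairing with \<open>Q\<close> of lower degree becomes a weighted integral of
  \<open>chebyshev_U k\<close> against a polynomial of degree below \<open>k\<close>.\<close>

lemma ridge_cheb_in_orth_poly_space: "ridge_cheb k \<theta> \<in> orth_poly_space k"
proof -
  have "inner_disk (ridge_cheb k \<theta>) Q = 0" if Q: "Q \<in> poly2_upto (int k - 1)" for Q
  proof (cases k)
    \<comment> \<open>The degree bound is -1, so the test space is trivial.\<close>
    case 0
    then have "Q = (\<lambda>_. 0)" using Q by (intro poly2_upto_neg[of "int k - 1"]) auto
    then show ?thesis by simp
  next
    case (Suc j)
    then obtain G where "degree G \<le> j" "\<And>q. inner_disk Q (ridge q \<theta>) = cheb_integral (G * q)"
      using radon_poly2[of Q j \<theta>] Q by auto
    then show ?thesis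
      using Suc by (simp add: inner_disk_commute[of _ Q] cheb_integral_U_eq_0)
  qed
  then show ?thesis
    using poly2_upto_mono[OF poly2_upto_ridge[of "chebyshev_U k" \<theta>], of "int k"] degree_chebyshev_U_le[of k]
    by (simp add: orth_poly_space_alt)
qed

text \<open>Orthogonality of \<open>P\<close> to ridge functions of lower degree passes to the
  polynomial \<open>G\<close> of its Radon projection; the factor 2 in \<open>poly G 1\<close>
  cancels the 2 in \<open>cheb_integral_orthogonal_U\<close>.\<close>

lemma inner_disk_ridge_cheb:
  assumes "P \<in> orth_poly_space k"
  shows "inner_disk P (ridge_cheb k \<theta>) = pi / real (k + 1) * P (cos \<theta>, sin \<theta>)"
proof -
  have P: "P \<in> poly2_upto (int k)" and orth: "\<And>Q. Q \<in> poly2_upto (int k - 1) \<Longrightarrow> inner_disk P Q = 0"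
    using assms by (auto simp: orth_poly_space_alt)
  obtain G where G: "degree G \<le> k" "poly G 1 = 2 * P (cos \<theta>, sin \<theta>)"
    "\<And>q. inner_disk P (ridge q \<theta>) = cheb_integral (G * q)"
    using radon_poly2[OF P, of \<theta>] by blast
  have "cheb_integral (G * q) = 0" if "degree q < k" for q
    using that poly2_upto_mono[OF poly2_upto_ridge[of q \<theta>], of "int k - 1"] by (simp flip: G(3) add: orth)
  then have "cheb_integral (G * chebyshev_U k) = pi / (2 * real (k + 1)) * poly G 1"
    using G(1) by (rule cheb_integral_orthogonal_U[rotated])
  then show ?thesis by (simp add: G(2,3) field_simps)
qed

text \<open>If \<open>P\<close> vanishes on the circle then it is orthogonal to all \<open>(a x + b y)\<^sup>k\<close>, hence to all
  monomials of degree \<open>k\<close>, and so to itself.\<close>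

lemma orth_poly_space_circle_eq_0:
  assumes "P \<in> orth_poly_space k" and circle: "\<And>\<theta>. P (cos \<theta>, sin \<theta>) = 0"
  shows "P = (\<lambda>_. 0)"
proof -
  have P: "P \<in> poly2_upto (int k)" and orth: "\<And>Q. Q \<in> poly2_upto (int k - 1) \<Longrightarrow> inner_disk P Q = 0"
    using assms(1) by (auto simp: orth_poly_space_alt)
  note pairable = disk_pairable_poly2[OF P]
  have ridge_U: "inner_disk P (ridge_cheb l \<theta>) = 0" if "l \<le> k" for l \<theta>
  proof (cases "l = k")
    case True
    then show ?thesis using inner_disk_ridge_cheb[OF assms(1)] circle by simp
  next
    case False
    then show ?thesis
      using that poly2_upto_mono[OF poly2_upto_ridge[of "chebyshev_U l" \<theta>], of "int k - 1"]
        degree_chebyshev_U_le[of l] by (intro orth) simp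
  qed
  have ridge_0: "inner_disk P (ridge (monom 1 k) \<theta>) = 0" for \<theta>
  proof -
    obtain a where "monom 1 k = (\<Sum>l\<le>k. smult (a l) (chebyshev_U l))"
      using chebyshev_U_span[OF degree_monom_le] by blast
    then have "inner_disk P (ridge (monom 1 k) \<theta>) = inner_disk P (\<lambda>p. \<Sum>l\<le>k. a l * ridge_cheb l \<theta> p)"
      by (simp add: ridge_sum)
    also have "\<dots> = (\<Sum>l\<le>k. a l * inner_disk P (ridge_cheb l \<theta>))"
      using degree_chebyshev_U_le
      by (intro inner_disk_sum_right[where n = "int k"] pairable poly2_upto_mono[OF poly2_upto_ridge])
        (auto intro: order_trans)
    finally show ?thesis by (simp add: ridge_U)
  qed
  \<comment> \<open>\<open>poly h z\<close> will be the pairing of \<open>P\<close> with the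
    \<open>k\<close>-th power of \<open>x + z * y\<close>, so its coefficients are binomial
    multiples of the moments \<open>M i\<close>. The factor \<open>1\<close> matches the shape of
    \<open>poly2_upto_monomial\<close>.\<close>
  define M where "M i = inner_disk P (\<lambda>(x, y). 1 * x ^ (k - i) * y ^ i)" for i
  define h where "h = (\<Sum>i\<le>k. monom (of_nat (k choose i) * M i) i)"
  have "poly h z = 0" for z
  proof -
    \<comment> \<open>Every real \<open>z\<close> is the tangent of an angle with nonzero cosine;
      dividing the linear form by that cosine yields \<open>x + z * y\<close>.\<close>
    define \<theta> where "\<theta> = arctan z"
    have c: "cos \<theta> \<noteq> 0" and z: "z = tan \<theta>" by (simp_all add: \<theta>_def tan_arctan)
    have eq: "(1 / cos \<theta>) ^ k * ridge (monom 1 k) \<theta> p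
        = (\<Sum>i\<le>k. (of_nat (k choose i) * z ^ i) * (case p of (x, y) \<Rightarrow> 1 * x ^ (k - i) * y ^ i))" for p
    proof (cases p)
      case (Pair x y)
      have "(1 / cos \<theta>) ^ k * ridge (monom 1 k) \<theta> p = ((x * cos \<theta> + y * sin \<theta>) / cos \<theta>) ^ k"
        by (simp add: Pair ridge_def poly_monom power_divide)
      also have "(x * cos \<theta> + y * sin \<theta>) / cos \<theta> = z * y + x"
        using c by (simp add: z tan_def field_simps)
      finally show ?thesis
        by (simp add: Pair binomial_ring power_mult_distrib mult_ac)
    qed
    have "0 = inner_disk P (\<lambda>p. (1 / cos \<theta>) ^ k * ridge (monom 1 k) \<theta> p)"
      by (simp only: inner_disk_cmult_right ridge_0 mult_zero_right)
    also have "\<dots> = (\<Sum>i\<le>k. (of_nat (k choose i) * z ^ i) * M i)"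
      unfolding eq M_def
      by (intro inner_disk_sum_right[where n = "int k"] pairable poly2_upto_monomial) auto
    finally show ?thesis by (simp add: h_def poly_sum poly_monom mult_ac)
  qed
  then have "h = 0" using poly_eqI_Ioo[of 0 1 h 0] by simp
  then have M_0: "M i = 0" if "i \<le> k" for i
  proof -
    have "coeff h i = of_nat (k choose i) * M i"
      using that by (simp add: h_def coeff_sum)
    then show ?thesis using \<open>h = 0\<close> that by simp
  qed
  \<comment> \<open>Membership is carried through the induction because additivity of
    \<open>inner_disk\<close> asks for it.\<close>
  have "Q \<in> poly2_upto (int k) \<and> inner_disk P Q = 0" if "Q \<in> poly2_upto (int k)" for Q
    using that
  proof (induction rule: poly2_upto_induct)
    case zero
    then show ?case by (simp add: poly2_upto_zero)
  next
    case (add A B)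
    then show ?case using pairable by (auto simp: inner_disk_add_right intro: poly2_upto_add)
  next
    case (monomial c i j)
    have "inner_disk P (\<lambda>(x, y). 1 * x ^ i * y ^ j) = 0"
    proof (cases "i + j = k")
      case True
      then show ?thesis using M_0[of j] by (auto simp: M_def)
    next
      case False
      then show ?thesis using monomial by (intro orth poly2_upto_monomial) auto
    qed
    then have "inner_disk P (\<lambda>p. c * (case p of (x, y) \<Rightarrow> 1 * x ^ i * y ^ j)) = 0"
      by (simp only: inner_disk_cmult_right mult_zero_right)
    then show ?case
      using poly2_upto_monomial[OF monomial] by (simp add: case_prod_unfold mult.assoc)
  qed
  then show ?thesis using P by (intro inner_disk_self_eq_0[OF P]) blast
qed

section \<open>The reproducing kernel and the projection\<close>

text \<open>Both sides lie in the same orthogonal space, so comparison on the circle suffices, and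
  there it is \<open>chebU_cos_quadrature\<close>.\<close>

lemma ridge_cheb_quadrature:
  assumes "k \<le> 2 * m"
  shows "real (2 * m + 1) * ridge_cheb k \<alpha> p
    = (\<Sum>\<nu>=0..2*m. chebU k (cos (angle m \<nu> - \<alpha>)) * ridge_cheb k (angle m \<nu>) p)"
proof -
  let ?D = "\<lambda>p. ridge_cheb k \<alpha> p - (\<Sum>\<nu>=0..2*m.
    chebU k (cos (angle m \<nu> - \<alpha>)) / real (2 * m + 1) * ridge_cheb k (angle m \<nu>) p)"
  have "?D = (\<lambda>_. 0)"
  proof (rule orth_poly_space_circle_eq_0)
    show "?D \<in> orth_poly_space k"
      by (intro orth_poly_space_diff orth_poly_space_sum ridge_cheb_in_orth_poly_space)
    show "?D (cos \<theta>, sin \<theta>) = 0" for \<theta>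
      using chebU_cos_quadrature[OF assms, of \<theta> \<alpha>]
      by (simp add: ridge_cheb_circle mult.commute flip: sum_divide_distrib)
  qed
  then have "?D p = 0" by (rule fun_cong)
  then show ?thesis by (simp flip: sum_divide_distrib)
qed

text \<open>Again compared on the circle: at angle \<open>\<alpha>\<close> the sum collapses to the
  pairing of \<open>Q\<close> with one ridge function, a known multiple of the boundary value. The
  constant inverts that multiple and the number of nodes.\<close>

lemma orth_poly_space_reproducing:
  assumes Q: "Q \<in> orth_poly_space k" and k: "k \<le> 2 * m"
  shows "Q p = (\<Sum>\<nu>=0..2*m. real (k + 1) / (pi * real (2 * m + 1)) *
    inner_disk Q (ridge_cheb k (angle m \<nu>)) * ridge_cheb k (angle m \<nu>) p)"
proof -
  let ?c = "real (k + 1) / (pi * real (2 * m + 1))"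
  let ?T = "\<lambda>p. \<Sum>\<nu>=0..2*m. ?c * inner_disk Q (ridge_cheb k (angle m \<nu>)) * ridge_cheb k (angle m \<nu>) p"
  have "(\<lambda>p. Q p - ?T p) = (\<lambda>_. 0)"
  proof (rule orth_poly_space_circle_eq_0)
    show "(\<lambda>p. Q p - ?T p) \<in> orth_poly_space k"
      by (intro orth_poly_space_diff orth_poly_space_sum ridge_cheb_in_orth_poly_space Q)
    fix \<alpha>
    have "real (2 * m + 1) * inner_disk Q (ridge_cheb k \<alpha>)
        = inner_disk Q (\<lambda>p. \<Sum>\<nu>=0..2*m. chebU k (cos (angle m \<nu> - \<alpha>)) * ridge_cheb k (angle m \<nu>) p)"
      by (simp only: flip: inner_disk_cmult_right ridge_cheb_quadrature[OF k])
    also have "\<dots> = (\<Sum>\<nu>=0..2*m. chebU k (cos (angle m \<nu> - \<alpha>)) * inner_disk Q (ridge_cheb k (angle m \<nu>)))"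
      using Q ridge_cheb_in_orth_poly_space
      by (intro inner_disk_sum_right[where n = "int k"] disk_pairable_poly2[where n = "int k"])
        (auto simp: orth_poly_space_alt)
    \<comment> \<open>Evenness of the cosine lets the node and the boundary angle change
      places.\<close>
    also have "\<dots> = (\<Sum>\<nu>=0..2*m. ridge_cheb k (angle m \<nu>) (cos \<alpha>, sin \<alpha>) * inner_disk Q (ridge_cheb k (angle m \<nu>)))"
      by (intro sum.cong refl) (simp add: ridge_cheb_circle cos_diff mult.commute)
    finally have "real (2 * m + 1) * (pi / real (k + 1) * Q (cos \<alpha>, sin \<alpha>)) = \<dots>"
      by (simp only: inner_disk_ridge_cheb[OF Q])
    moreover have "?T (cos \<alpha>, sin \<alpha>) = ?c *
        (\<Sum>\<nu>=0..2*m. ridge_cheb k (angle m \<nu>) (cos \<alpha>, sin \<alpha>) * inner_disk Q (ridge_cheb k (angle m \<nu>)))"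
      unfolding sum_distrib_left by (intro sum.cong refl) (simp only: mult_ac)
    ultimately have "?T (cos \<alpha>, sin \<alpha>) = ?c * (real (2 * m + 1) * (pi / real (k + 1) * Q (cos \<alpha>, sin \<alpha>)))"
      by simp
    also have "\<dots> = Q (cos \<alpha>, sin \<alpha>)"
      by (simp add: field_simps del: of_nat_Suc)
    finally show "Q (cos \<alpha>, sin \<alpha>) - ?T (cos \<alpha>, sin \<alpha>) = 0" by simp
  qed
  then have "Q p - ?T p = 0" by (rule fun_cong)
  then show ?thesis by (simp only: right_minus_eq)
qed

text \<open>For the definite description uniqueness is needed too: the difference of two candidates
  is orthogonal to itself.\<close>

lemma proj_eqI:
  assumes f: "disk_pairable f" and F: "F \<in> orth_poly_space k"
    and orth: "\<And>Q. Q \<in> orth_poly_space k \<Longrightarrow> inner_disk f Q = inner_disk F Q"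
  shows "proj k f = F"
  unfolding proj_def
proof (rule the_equality)
  have pairable: "disk_pairable P" if "P \<in> orth_poly_space k" for P
    using that by (auto simp: orth_poly_space_alt intro: disk_pairable_poly2)
  have diff: "inner_disk (\<lambda>p. f p - P p) Q = inner_disk f Q - inner_disk P Q"
    if "P \<in> orth_poly_space k" "Q \<in> orth_poly_space k" for P Q
    using that pairable[OF that(1)] f
    by (intro inner_disk_diff_left[where n = "int k"]) (auto simp: orth_poly_space_alt)
  show "F \<in> orth_poly_space k \<and> (\<forall>Q\<in>orth_poly_space k. inner_disk (\<lambda>p. f p - F p) Q = 0)"
    using F orth by (simp add: diff)
  fix P assume P: "P \<in> orth_poly_space k \<and> (\<forall>Q\<in>orth_poly_space k. inner_disk (\<lambda>p. f p - P p) Q = 0)"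
  let ?D = "\<lambda>p. P p - F p"
  have D: "?D \<in> orth_poly_space k" using P F by (intro orth_poly_space_diff) auto
  have "inner_disk P ?D = inner_disk f ?D" using P D diff[of P ?D] by auto
  then have "inner_disk ?D ?D = 0"
    using P F D orth[OF D] pairable inner_disk_diff_left[of P F ?D "int k"]
    by (auto simp: orth_poly_space_alt)
  then have "?D = (\<lambda>_. 0)" using D by (intro inner_disk_self_eq_0[of _ "int k"]) (auto simp: orth_poly_space_alt)
  then show "P = F" by (simp add: fun_eq_iff)
qed

text \<open>Expanding the test polynomial \<open>Q\<close> by the reproducing formula gives a sum
  symmetric in \<open>f\<close> and \<open>Q\<close>, which is also the pairing of \<open>Q\<close>
  with the claimed projection.\<close>

lemma proj_eq_ridge_sum:
  assumes f: "disk_pairable f" and k: "k \<le> 2 * m"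
  shows "proj k f = (\<lambda>p. \<Sum>\<nu>=0..2*m. real (k + 1) / (pi * real (2 * m + 1)) *
    inner_disk f (ridge_cheb k (angle m \<nu>)) * ridge_cheb k (angle m \<nu>) p)" (is "_ = ?F")
proof (rule proj_eqI[OF f])
  show F: "?F \<in> orth_poly_space k"
    by (intro orth_poly_space_sum ridge_cheb_in_orth_poly_space)
  fix Q assume Q: "Q \<in> orth_poly_space k"
  have U: "ridge_cheb k \<theta> \<in> poly2_upto (int k)" for \<theta>
    using ridge_cheb_in_orth_poly_space by (auto simp: orth_poly_space_alt)
  have Q': "disk_pairable Q" using Q by (auto simp: orth_poly_space_alt intro: disk_pairable_poly2)
  let ?c = "real (k + 1) / (pi * real (2 * m + 1))"
  have "inner_disk f Q = inner_disk f (\<lambda>p. \<Sum>\<nu>=0..2*m. ?c *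
      inner_disk Q (ridge_cheb k (angle m \<nu>)) * ridge_cheb k (angle m \<nu>) p)"
    by (rule arg_cong[of Q _ "inner_disk f"], rule ext) (rule orth_poly_space_reproducing[OF Q k])
  also have "\<dots> = (\<Sum>\<nu>=0..2*m. ?c * inner_disk Q (ridge_cheb k (angle m \<nu>)) * inner_disk f (ridge_cheb k (angle m \<nu>)))"
    by (intro inner_disk_sum_right[where n = "int k", OF f] U)
  also have "\<dots> = (\<Sum>\<nu>=0..2*m. ?c * inner_disk f (ridge_cheb k (angle m \<nu>)) * inner_disk Q (ridge_cheb k (angle m \<nu>)))"
    by (simp only: mult_ac)
  also have "\<dots> = inner_disk Q ?F"
    by (intro inner_disk_sum_right[where n = "int k", OF Q', symmetric] U)
  finally show "inner_disk f Q = inner_disk ?F Q" by (simp only: inner_disk_commute)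
qed

text \<open>The integrability claims ensure that the identity does not rest on default values of
  integrals.\<close>

theorem theorem3p6:
  fixes \<eta> :: "real \<Rightarrow> real" and r m :: nat and f :: "real \<times> real \<Rightarrow> real"
  assumes "multiplier_function r \<eta>"
    and "m \<ge> 1"
    and "f \<in> L2_disk"
  shows "(\<forall>\<nu>\<in>{0..2*m}. AE t in lebesgue_on {-1..1}.
            set_integrable lebesgue {- sqrt (1 - t\<^sup>2)..sqrt (1 - t\<^sup>2)} (chord_fun (angle m \<nu>) f t)) \<and>
         (\<forall>x y.
            (\<forall>\<nu>\<in>{0..2*m}. set_integrable lebesgue {-1..1}
               (\<lambda>t. radon (angle m \<nu>) f t * Phi \<eta> m \<nu> t x y)) \<and>
            S_op \<eta> m f (x, y) =
              (\<Sum>\<nu>=0..2*m. 1 / pi *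
                 (LINT t:{-1..1}|lebesgue. radon (angle m \<nu>) f t * Phi \<eta> m \<nu> t x y)))"
proof (intro conjI allI ballI)
  have f: "disk_pairable f" using assms(3) by (rule disk_pairable_L2)
  have f_int: "set_integrable lebesgue B2 f"
    using f[unfolded disk_pairable_def, rule_format, of "\<lambda>_. 1"] by simp
  show "AE t in lebesgue_on {-1..1}.
      set_integrable lebesgue {- sqrt (1 - t\<^sup>2)..sqrt (1 - t\<^sup>2)} (chord_fun (angle m \<nu>) f t)" for \<nu>
    using AE_chord_integrable[OF f_int, of "angle m \<nu>"] by (subst AE_restrict_space_iff) auto
  fix x y :: real
  \<comment> \<open>For fixed \<open>(x, y)\<close> the function \<open>Phi\<close> is a polynomial
    in \<open>t\<close>, with these coefficients in the Chebyshev basis; hence a single ridge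
    pairing yields its integral against the Radon projection.\<close>
  define w where "w \<nu> k = \<eta> (real k / real m) * real (k + 1) * ridge_cheb k (angle m \<nu>) (x, y) / real (2 * m + 1)" for \<nu> k
  define q where "q \<nu> = (\<Sum>k=0..2*m. smult (w \<nu> k) (chebyshev_U k))" for \<nu>
  have Phi_poly: "Phi \<eta> m \<nu> t x y = poly (q \<nu>) t" for \<nu> t
    by (simp add: Phi_def q_def w_def poly_sum ridge_U_def ridge_def sum_distrib_left mult_ac)
  show "set_integrable lebesgue {-1..1} (\<lambda>t. radon (angle m \<nu>) f t * Phi \<eta> m \<nu> t x y)" for \<nu>
    unfolding Phi_poly by (rule radon_ridge_integrable[OF f])
  have "S_op \<eta> m f (x, y) = (\<Sum>k=0..2*m. \<Sum>\<nu>=0..2*m. 1 / pi * (w \<nu> k * inner_disk f (ridge_cheb k (angle m \<nu>))))"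
    unfolding S_op_def
  \<comment> \<open>The same nodes serve every \<open>k \<le> 2 * m\<close>, so the two sums can be
    exchanged afterwards.\<close>
  proof (intro sum.cong refl)
    fix k assume "k \<in> {0..2*m}"
    then show "\<eta> (real k / real m) * proj k f (x, y)
        = (\<Sum>\<nu>=0..2*m. 1 / pi * (w \<nu> k * inner_disk f (ridge_cheb k (angle m \<nu>))))"
      by (simp add: proj_eq_ridge_sum[OF f] w_def sum_distrib_left mult_ac)
  qed
  also have "\<dots> = (\<Sum>\<nu>=0..2*m. 1 / pi * (\<Sum>k=0..2*m. w \<nu> k * inner_disk f (ridge_cheb k (angle m \<nu>))))"
    by (subst sum.swap) (simp only: sum_distrib_left)
  also have "\<dots> = (\<Sum>\<nu>=0..2*m. 1 / pi * inner_disk f (ridge (q \<nu>) (angle m \<nu>)))"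
  proof (intro sum.cong refl arg_cong[of _ _ "(*) (1 / pi)"])
    fix \<nu>
    show "(\<Sum>k=0..2*m. w \<nu> k * inner_disk f (ridge_cheb k (angle m \<nu>))) = inner_disk f (ridge (q \<nu>) (angle m \<nu>))"
      unfolding q_def ridge_sum using order_trans[OF degree_chebyshev_U_le]
      by (intro inner_disk_sum_right[where n = "int (2 * m)", OF f, symmetric] poly2_upto_mono[OF poly2_upto_ridge])
        (simp only: of_nat_le_iff atLeastAtMost_iff)
  qed
  finally show "S_op \<eta> m f (x, y) = (\<Sum>\<nu>=0..2*m. 1 / pi *
      (LINT t:{-1..1}|lebesgue. radon (angle m \<nu>) f t * Phi \<eta> m \<nu> t x y))"
    unfolding Phi_poly by (simp only: inner_disk_ridge[OF f])
qed

end
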